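(* Let $\mathbb{K}\in\{\mathbb{R},\mathbb{C}\}$, let $\mathcal{X}$ be a separable topological $\mathbb{K}$-vector space whose topological dual $\mathcal{X}^{\ast}$ separates the points of $\mathcal{X}$, and let $\mathcal{U}$ be a $0$-neighborhood in $\mathcal{X}$. Fix a countable dense set $(A_n)_{n\in\mathbb{N}}\subseteq\mathcal{X}$ and define on $\mathcal{U}^{\circ}$ the metric $d(\sigma_1,\sigma_2)=\sum_{n\in\mathbb{N}}\frac{2^{-n}}{1+\max_{\sigma\in\mathcal{U}^{\circ}}|\sigma(A_n)|}|(\sigma_1-\sigma_2)(A_n)|$, and for $U_1,U_2\in\mathbf{CU}_{\mathcal{U}}(\mathcal{X}^{\ast})$ the Hausdorff distance $\mathfrak{d}_H(U_1,U_2)=\max\{\max_{\sigma_1\in U_1}\min_{\sigma_2\in U_2}d(\sigma_1,\sigma_2),\ \max_{\sigma_2\in U_2}\min_{\sigma_1\in U_1}d(\sigma_1,\sigma_2)\}$. Then the family $\{\{U_2\in\mathbf{CU}_{\mathcal{U}}(\mathcal{X}^{\ast}):\mathfrak{d}_H(U_1,U_2)<r\}: r>0,\ U_1\in\mathbf{CU}_{\mathcal{U}}(\mathcal{X}^{\ast})\}$ is a basis of the weak*-Hausdorff hypertopology on $\mathbf{CU}_{\mathcal{U}}(\mathcal{X}^{\ast})$. Moreover, $\mathbf{CU}_{\mathcal{U}}(\mathcal{X}^{\ast})$ is compact and completely metrizable in the weak*-Hausdorff hypertopology.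
   Context: Topological vector spaces are Hausdorff. $\mathcal{X}^{\ast}$ carries the weak* topology. The absolute polar of $\mathcal{U}$ is $\mathcal{U}^{\circ}=\{\sigma\in\mathcal{X}^{\ast}:|\sigma(A)|\le1\ \forall A\in\mathcal{U}\}$ (a weak*-compact convex set). $\mathbf{CU}_{\mathcal{U}}(\mathcal{X}^{\ast})$ is the set of nonempty convex weak*-closed subsets of $\mathcal{X}^{\ast}$ contained in $\mathcal{U}^{\circ}$. The weak*-Hausdorff hypertopology is the topology generated by the extended pseudometrics $d_H^{(A)}(F,\tilde F)=\max\{\sup_{\sigma\in F}\inf_{\tilde\sigma\in\tilde F}|(\sigma-\tilde\sigma)(A)|,\ \sup_{\tilde\sigma\in\tilde F}\inf_{\sigma\in F}|(\sigma-\tilde\sigma)(A)|\}$, $A\in\mathcal{X}$. *)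

theory Defs
  imports "HOL-Analysis.Analysis"
begin

definition tvs :: "('k::real_normed_field \<Rightarrow> 'a::ab_group_add \<Rightarrow> 'a) \<Rightarrow> 'a topology \<Rightarrow> bool" where
  "tvs smul T \<longleftrightarrow> vector_space smul \<and> topspace T = UNIV \<and> Hausdorff_space T \<and>
     continuous_map (prod_topology T T) T (\<lambda>(x, y). x + y) \<and>
     continuous_map (prod_topology euclidean T) T (\<lambda>(c, x). smul c x)"

definition tdual :: "('k::real_normed_field \<Rightarrow> 'a::ab_group_add \<Rightarrow> 'a) \<Rightarrow> 'a topology \<Rightarrow> ('a \<Rightarrow> 'k) set" where
  "tdual smul T = {f. Vector_Spaces.linear smul (*) f \<and> continuous_map T euclidean f}"

definition weakstar :: "('k::real_normed_field \<Rightarrow> 'a::ab_group_add \<Rightarrow> 'a) \<Rightarrow> 'a topology \<Rightarrow> ('a \<Rightarrow> 'k) topology" where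
  "weakstar smul T = subtopology (product_topology (\<lambda>_. euclidean) UNIV) (tdual smul T)"

definition zero_nhd :: "'a topology \<Rightarrow> 'a::ab_group_add set \<Rightarrow> bool" where
  "zero_nhd T U \<longleftrightarrow> (\<exists>V. openin T V \<and> 0 \<in> V \<and> V \<subseteq> U)"

definition polar :: "('k::real_normed_field \<Rightarrow> 'a::ab_group_add \<Rightarrow> 'a) \<Rightarrow> 'a topology \<Rightarrow> 'a set \<Rightarrow> ('a \<Rightarrow> 'k) set" where
  "polar smul T U = {\<sigma> \<in> tdual smul T. \<forall>A\<in>U. norm (\<sigma> A) \<le> 1}"

definition fconvex :: "('a \<Rightarrow> 'k::real_normed_field) set \<Rightarrow> bool" where
  "fconvex F \<longleftrightarrow> (\<forall>f\<in>F. \<forall>g\<in>F. \<forall>t::real. 0 \<le> t \<and> t \<le> 1 \<longrightarrow>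
      (\<lambda>x. of_real t * f x + of_real (1 - t) * g x) \<in> F)"

definition CU :: "('k::real_normed_field \<Rightarrow> 'a::ab_group_add \<Rightarrow> 'a) \<Rightarrow> 'a topology \<Rightarrow> 'a set \<Rightarrow> ('a \<Rightarrow> 'k) set set" where
  "CU smul T U = {F. F \<noteq> {} \<and> fconvex F \<and> closedin (weakstar smul T) F \<and> F \<subseteq> polar smul T U}"

text \<open>The extended pseudometric d_H^(A) (real valued here; on CU it is finite).\<close>
definition dHA :: "'a \<Rightarrow> ('a \<Rightarrow> 'k::real_normed_field) set \<Rightarrow> ('a \<Rightarrow> 'k) set \<Rightarrow> real" where
  "dHA A F G = max (SUP \<sigma>\<in>F. INF \<tau>\<in>G. norm (\<sigma> A - \<tau> A))
                   (SUP \<tau>\<in>G. INF \<sigma>\<in>F. norm (\<sigma> A - \<tau> A))"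

definition wsH_topology :: "('k::real_normed_field \<Rightarrow> 'a::ab_group_add \<Rightarrow> 'a) \<Rightarrow> 'a topology \<Rightarrow> 'a set \<Rightarrow> ('a \<Rightarrow> 'k) set topology" where
  "wsH_topology smul T U = topology_generated_by
     {{G \<in> CU smul T U. dHA A F G < r} | A F r. F \<in> CU smul T U \<and> r > 0}"

definition polar_metric :: "('k::real_normed_field \<Rightarrow> 'a::ab_group_add \<Rightarrow> 'a) \<Rightarrow> 'a topology \<Rightarrow> 'a set \<Rightarrow> (nat \<Rightarrow> 'a) \<Rightarrow> ('a \<Rightarrow> 'k) \<Rightarrow> ('a \<Rightarrow> 'k) \<Rightarrow> real" where
  "polar_metric smul T U A \<sigma>1 \<sigma>2 =
     (\<Sum>n. (2 powr (- real n) / (1 + (SUP \<sigma>\<in>polar smul T U. norm (\<sigma> (A n))))) * norm (\<sigma>1 (A n) - \<sigma>2 (A n)))"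

definition frakdH :: "('k::real_normed_field \<Rightarrow> 'a::ab_group_add \<Rightarrow> 'a) \<Rightarrow> 'a topology \<Rightarrow> 'a set \<Rightarrow> (nat \<Rightarrow> 'a) \<Rightarrow> ('a \<Rightarrow> 'k) set \<Rightarrow> ('a \<Rightarrow> 'k) set \<Rightarrow> real" where
  "frakdH smul T U A U1 U2 = max
     (SUP \<sigma>1\<in>U1. INF \<sigma>2\<in>U2. polar_metric smul T U A \<sigma>1 \<sigma>2)
     (SUP \<sigma>2\<in>U2. INF \<sigma>1\<in>U1. polar_metric smul T U A \<sigma>1 \<sigma>2)"

end

theory Submission
  imports Defs "HOL-Computational_Algebra.Fundamental_Theorem_Algebra"
begin

text \<open>Let \<open>P\<close> be the polar of \<open>U\<close>. By Banach--Alaoglu and equicontinuity the metric \<open>d\<close> induces the compact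
  weak* topology on \<open>P\<close>, so the nonempty closed subsets of \<open>P\<close> form a compact metric space under the
  Hausdorff distance of \<open>d\<close>, in which the convex sets are a closed subspace. Each pseudometric \<open>dHA\<close> is
  continuous for this distance, so the identity maps this compact space continuously onto the hypertopology.
  The latter is Hausdorff because a point outside a compact convex set is separated from it by evaluation at
  a single vector; here convexity is essential. Hence the two topologies coincide.

  The scalars range over an arbitrary \<open>real_normed_field\<close>, so a Gelfand--Mazur theorem is needed to know
  that they are locally compact and carry a conjugation.\<close>

section \<open>Real normed fields\<close>

text \<open>A single \<open>dHA\<close> sees one vector only, while \<open>frakdH\<close> weighs all
  coordinates at once, so no direct estimate of \<open>frakdH\<close> by finitely many
  \<open>dHA\<close> is at hand. Compactness replaces it: only the easy control of
  \<open>dHA\<close> by \<open>frakdH\<close> and the separation of distinct sets have to be proved.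
  The unit circle and the unit disc in the dual of the real plane show why separation needs
  convexity: every evaluation has the same image on both.

  The scalar field need not be complete, but its norm is multiplicative. The Gelfand--Mazur step
  therefore avoids power series: it minimises the norm of \<open>(x - a)^2 + c\<close> over real
  \<open>a\<close> and \<open>c \<ge> 0\<close> and shows that a positive minimum is
  impossible.\<close>

definition real_poly_at :: "real poly \<Rightarrow> 'k::real_normed_field \<Rightarrow> 'k" where
  "real_poly_at p x = poly (map_poly of_real p) x"

lemma real_poly_at_0 [simp]: "real_poly_at 0 x = 0"
  by (simp add: real_poly_at_def)

lemma real_poly_at_pCons [simp]: "real_poly_at (pCons a p) x = of_real a + x * real_poly_at p x"
  by (simp add: real_poly_at_def map_poly_pCons)

lemma real_poly_at_add: "real_poly_at (p + q) x = real_poly_at p x + real_poly_at q x"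
proof -
  have "map_poly of_real (p + q) = map_poly of_real p + (map_poly of_real q :: 'a poly)"
    by (intro poly_eqI) (simp add: coeff_map_poly)
  then show ?thesis by (simp add: real_poly_at_def)
qed

lemma real_poly_at_smult: "real_poly_at (smult c p) x = of_real c * real_poly_at p x"
  by (simp add: real_poly_at_def map_poly_smult)

lemma real_poly_at_diff: "real_poly_at (p - q) x = real_poly_at p x - real_poly_at q x"
  using real_poly_at_add[of "p - q" q x] by simp

lemma real_poly_at_mult: "real_poly_at (p * q) x = real_poly_at p x * real_poly_at q x"
  by (induction p) (simp_all add: real_poly_at_add real_poly_at_smult algebra_simps)

lemma real_poly_at_1 [simp]: "real_poly_at 1 x = 1"
  by (simp add: one_pCons)

lemma real_poly_at_power: "real_poly_at (p ^ n) x = real_poly_at p x ^ n"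
  by (induction n) (simp_all add: real_poly_at_mult)

text \<open>A complex root \<open>w\<close> decides the case: if it is not real, the factor is
  \<open>(X - w)(X - cnj w) = (X - a)^2 + b^2\<close>, the shape of the expression minimised
  later.\<close>

lemma real_poly_linear_or_quadratic_factor:
  fixes p :: "real poly"
  assumes "degree p \<noteq> 0"
  shows "(\<exists>a. [:-a, 1:] dvd p) \<or> (\<exists>a b. [:a^2 + b^2, - 2 * a, 1:] dvd p)"
proof -
  have "\<not> constant (poly (map_poly of_real p :: complex poly))"
    using assms by (simp add: constant_degree degree_map_poly)
  then obtain w :: complex where w: "real_poly_at p w = 0"
    using fundamental_theorem_of_algebra unfolding real_poly_at_def by blast
  show ?thesis
  proof (cases "Im w = 0")
    case True
    have "real_poly_at q (complex_of_real (Re w)) = of_real (poly q (Re w))" for q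
      by (induction q) simp_all
    moreover have "w = of_real (Re w)" using True by (simp add: complex_eq_iff)
    ultimately have "poly p (Re w) = 0" using w by (metis of_real_eq_0_iff)
    then show ?thesis by (auto simp: poly_eq_0_iff_dvd)
  next
    case False
    define q where "q = [:(Re w)^2 + (Im w)^2, - 2 * Re w, 1:]"
    have qw: "real_poly_at q w = 0"
      by (simp add: q_def complex_eq_iff power2_eq_square algebra_simps)
    define r where "r = p mod q"
    have "degree r < 2 \<or> r = 0"
      using degree_mod_less[of q p] by (auto simp: q_def r_def)
    then have "degree r \<le> 1" by auto
    then have "r = [:coeff r 0, coeff r 1:]"
      by (intro poly_eqI) (auto simp: coeff_pCons coeff_eq_0 split: nat.split)
    then obtain a b where r: "r = [:a, b:]" by blast
    have "p = (p div q) * q + r" by (simp add: r_def)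
    then have "real_poly_at r w = 0"
      using w qw by (metis add_0 mult_zero_right real_poly_at_add real_poly_at_mult)
    \<comment> \<open>\<open>Im w\<close> is nonzero, so the imaginary part of
      \<open>a + w * b\<close> vanishes only for \<open>b = 0\<close>.\<close>
    then have "b = 0" "a = 0"
      using False by (auto simp: r complex_eq_iff)
    then have "r = 0" using r by simp
    then have "q dvd p" by (simp add: r_def mod_eq_0_iff_dvd)
    then show ?thesis unfolding q_def by blast
  qed
qed

text \<open>Lower bounds for factors multiply. A quadratic factor contributes at least
  \<open>m\<close>, a linear one at least \<open>sqrt m\<close> because its square is the case
  \<open>c = 0\<close>; this makes one \<open>sqrt m\<close> per degree.\<close>

lemma norm_real_poly_at_ge:
  fixes x :: "'k::real_normed_field"
  assumes m: "m \<ge> 0" and quad: "\<And>a c. c \<ge> 0 \<Longrightarrow> m \<le> norm ((x - of_real a)^2 + of_real c)"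
    and "lead_coeff p = 1"
  shows "sqrt m ^ degree p \<le> norm (real_poly_at p x)"
  using assms(3)
proof (induction "degree p" arbitrary: p rule: less_induct)
  case less
  have step: "sqrt m ^ degree p \<le> norm (real_poly_at p x)"
    if q: "lead_coeff q = 1" "degree q > 0" "q dvd p" "sqrt m ^ degree q \<le> norm (real_poly_at q x)" for q
  proof -
    obtain r where p: "p = q * r" using q(3) by blast
    have nz: "q \<noteq> 0" "r \<noteq> 0" using less.prems p by auto
    then have deg: "degree p = degree q + degree r" by (simp add: p degree_mult_eq)
    have "lead_coeff r = 1" using less.prems q(1) by (simp add: p lead_coeff_mult)
    then have "sqrt m ^ degree r \<le> norm (real_poly_at r x)"
      using less.hyps q(2) deg by simp
    then show ?thesis
      using q(4) m by (simp add: p deg[unfolded p] real_poly_at_mult norm_mult power_add mult_mono)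
  qed
  show ?case
  proof (cases "degree p = 0")
    case True
    then obtain c where "p = [:c:]" by (metis degree_eq_zeroE)
    then show ?thesis using less.prems by simp
  next
    case False
    from real_poly_linear_or_quadratic_factor[OF this] show ?thesis
    proof (elim disjE exE)
      fix a assume a: "[:-a, 1:] dvd p"
      have "m \<le> norm (x - of_real a) ^ 2" using quad[of 0 a] by (simp add: norm_power)
      then have "sqrt m \<le> norm (x - of_real a)" by (simp add: real_le_lsqrt m)
      then show ?thesis by (intro step[OF _ _ a]) simp_all
    next
      fix a b assume ab: "[:a^2 + b^2, - 2 * a, 1:] dvd p"
      have "m \<le> norm ((x - of_real a)^2 + of_real (b^2))" by (rule quad) simp
      also have "(x - of_real a)^2 + of_real (b^2) = real_poly_at [:a^2 + b^2, - 2 * a, 1:] x"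
        by (simp add: power2_eq_square algebra_simps)
      finally show ?thesis using m by (intro step[OF _ _ ab]) (simp_all add: numeral_2_eq_2)
    qed
  qed
qed

text \<open>With \<open>y = (x - a)\<^sup>2 + c\<close> of minimal norm \<open>m\<close>, the polynomial \<open>y\<^sup>n - (- \<epsilon>)\<^sup>n\<close> is divisible by \<open>y + \<epsilon>\<close>
  and the cofactor has norm at least \<open>m\<^sup>n\<^sup>-\<^sup>1\<close>; for \<open>n \<rightarrow> \<infinity>\<close> this forces \<open>norm (y + \<epsilon>) \<le> m\<close>, so that
  the minimum propagates to arbitrarily large \<open>c\<close>.\<close>
lemma norm_quadratic_shift_le:
  fixes x :: "'k::real_normed_field"
  assumes quad: "\<And>a c. c \<ge> 0 \<Longrightarrow> m \<le> norm ((x - of_real a)^2 + of_real c)"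
    and m: "norm ((x - of_real a)^2 + of_real c) = m" and eps: "0 < e" "e < m" 
  shows "norm ((x - of_real a)^2 + of_real (c + e)) \<le> m"
proof -
  define Y where "Y = [:a^2 + c, - 2 * a, 1:]"
  have Yx: "real_poly_at Y x = (x - of_real a)^2 + of_real c"
    by (simp add: Y_def power2_eq_square algebra_simps)
  define g where "g = Y + [:e:]"
  have gx: "real_poly_at g x = (x - of_real a)^2 + of_real (c + e)"
    by (simp add: g_def Yx real_poly_at_add)
  have "m > 0" using eps by linarith
  have bound: "norm (real_poly_at g x) \<le> m * (1 + (e / m) ^ n)" if "n > 0" for n
  proof -
    have "Y - [:-e:] dvd Y ^ n - [:-e:] ^ n" using dvd_power_same by (simp add: power_diff_sumr2)
    then obtain q where q: "Y ^ n - [:-e:] ^ n = g * q" 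
      by (metis g_def diff_minus_eq_add minus_pCons minus_zero dvdE)
    have lY: "lead_coeff Y = 1" "degree Y = 2" by (simp_all add: Y_def)
    have lg: "lead_coeff g = 1" "degree g = 2" by (simp_all add: Y_def g_def)
    have ce: "[:-e:] ^ n = [:(-e) ^ n:]" by (simp add: poly_const_pow)
    have "Y \<noteq> 0" using lY by auto
    then have dY: "degree (Y ^ n) = 2 * n" "lead_coeff (Y ^ n) = 1"
      using lY degree_power_eq[of Y n] lead_coeff_power[of Y n] by (auto simp: mult.commute)
    have dd: "degree (- ([:-e:] ^ n)) < degree (Y ^ n)" unfolding ce dY using that by simp
    have d1: "degree (Y ^ n - [:-e:] ^ n) = 2 * n"
      using degree_add_eq_left[OF dd] dY(1) by (simp only: diff_conv_add_uminus)
    moreover have "lead_coeff (Y ^ n - [:-e:] ^ n) = 1"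
      using dY that unfolding d1 by (simp add: ce coeff_eq_0)
    ultimately have "degree (g * q) = 2 * n" "lead_coeff (g * q) = 1" unfolding q[symmetric] by auto
    note gq = this
    have lq: "lead_coeff q = 1" using lead_coeff_mult[of g q] lg(1) gq(2) by (simp only: mult_1)
    then have "q \<noteq> 0" "g \<noteq> 0" using lg by auto
    \<comment> \<open>This degree turns the bound \<open>sqrt m ^ degree q\<close> into
      \<open>m ^ (n - 1)\<close>.\<close>
    then have "degree q = 2 * (n - 1)" using gq(1) lg(2) by (simp add: degree_mult_eq)
    with norm_real_poly_at_ge[OF _ quad lq] \<open>m > 0\<close>
    have "m ^ (n - 1) \<le> norm (real_poly_at q x)" by (simp add: power_mult)
    then have "norm (real_poly_at g x) * m ^ (n - 1) \<le> norm (real_poly_at g x) * norm (real_poly_at q x)"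
      by (intro mult_left_mono) auto
    also have "\<dots> = norm (real_poly_at (Y ^ n - [:-e:] ^ n) x)" by (simp add: q real_poly_at_mult norm_mult)
    also have "\<dots> = norm (real_poly_at Y x ^ n - (of_real ((-e) ^ n)))"
      by (simp add: ce real_poly_at_diff real_poly_at_power)
    also have "\<dots> \<le> m ^ n + e ^ n"
      by (rule order.trans[OF norm_triangle_ineq4]) (use eps in \<open>simp add: norm_power Yx m del: of_real_power\<close>)
    also have "\<dots> = m * (1 + (e / m) ^ n) * m ^ (n - 1)"
      using \<open>m > 0\<close> that by (cases n) (simp_all add: field_simps)
    finally show ?thesis using \<open>m > 0\<close> by simp
  qed
  \<comment> \<open>Here \<open>e < m\<close> matters: the error \<open>(e / m) ^ n\<close>
    vanishes.\<close>
  have "(\<lambda>n. m * (1 + (e / m) ^ n)) \<longlonglongrightarrow> m * (1 + 0)"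
    using eps \<open>m > 0\<close> by (intro tendsto_intros LIMSEQ_power_zero) simp
  moreover have "\<forall>\<^sub>F n in sequentially. norm (real_poly_at g x) \<le> m * (1 + (e / m) ^ n)"
    using eventually_gt_at_top[of 0] by eventually_elim (rule bound)
  ultimately have "norm (real_poly_at g x) \<le> m * (1 + 0)"
    by (rule tendsto_lowerbound) simp
  then show ?thesis by (simp add: gx)
qed

text \<open>The minimum over \<open>a\<close> and \<open>c \<ge> 0\<close> is attained by
  coercivity. If it were positive, repeated shifts of \<open>c\<close> by half the minimum would
  preserve it for arbitrarily large \<open>c\<close>, against the same coercivity.\<close>

lemma quadratic_root_exists:
  fixes x :: "'k::real_normed_field"
  shows "\<exists>a b. (x - of_real a)^2 + of_real (b^2) = 0"
proof -
  define f where "f = (\<lambda>(a, c). norm ((x - of_real a)^2 + of_real c))"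
  define N where "N = norm x"
  have N: "N \<ge> 0" by (simp add: N_def)
  have low: "a^2 + c \<le> f (a, c) + 2 * \<bar>a\<bar> * N + N^2" for a c
  proof -
    have "of_real (a^2 + c) = ((x - of_real a)^2 + of_real c) + of_real (2 * a) * x - x^2"
      by (simp add: power2_eq_square algebra_simps)
    then have "norm (of_real (a^2 + c) :: 'k) \<le> f (a, c) + norm (of_real (2 * a) * x) + norm (x^2)"
      unfolding f_def by (smt (verit) norm_triangle_ineq norm_triangle_ineq4 case_prod_conv)
    then show ?thesis by (simp add: norm_mult norm_power N_def del: of_real_add of_real_power)
  qed
  \<comment> \<open>The box comes from \<open>low\<close>: for \<open>c \<ge> 0\<close>, a value
    below \<open>f (0, 0) = N^2\<close> forces
    \<open>a^2 + c \<le> 2 * \<bar>a\<bar> * N + 2 * N^2\<close>, hence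
    \<open>\<bar>a\<bar> \<le> 4 * N\<close> and then
    \<open>c \<le> 8 * N^2 + 2 * N^2\<close>.\<close>
  define K where "K = cbox (- (4 * N), 0) (4 * N, 10 * N^2)"
  have "continuous_on K f" unfolding f_def case_prod_unfold by (intro continuous_intros)
  moreover have "compact K" "(0, 0) \<in> K" unfolding K_def using N by (simp_all only: compact_cbox) (simp add: cbox_Pair_eq)
  ultimately obtain z where z: "z \<in> K" "\<And>y. y \<in> K \<Longrightarrow> f z \<le> f y"
    using continuous_attains_inf[of K f] by blast
  obtain a0 c0 where z_def: "z = (a0, c0)" by (cases z)
  have c0: "c0 \<ge> 0" using z(1) by (auto simp: z_def K_def cbox_Pair_eq)
  define m where "m = f z"
  have min: "m \<le> norm ((x - of_real a)^2 + of_real c)" if "c \<ge> 0" for a c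
  proof (cases "(a, c) \<in> K")
    case True
    then show ?thesis using z(2)[OF True] by (simp add: m_def f_def)
  next
    case False
    have "m \<le> f (0, 0)" unfolding m_def using \<open>(0, 0) \<in> K\<close> z(2) by blast
    then have m0: "m \<le> N^2" by (simp add: f_def N_def norm_power)
    have "m \<le> f (a, c)"
    proof (rule ccontr)
      assume "\<not> m \<le> f (a, c)"
      then have le: "a^2 + c \<le> 2 * \<bar>a\<bar> * N + 2 * N^2" using low[of a c] m0 by linarith
      have a4: "\<bar>a\<bar> \<le> 4 * N"
      proof (rule ccontr)
        assume "\<not> \<bar>a\<bar> \<le> 4 * N"
        then have "(4 * N) * \<bar>a\<bar> < \<bar>a\<bar> * \<bar>a\<bar>" "N * (4 * N) \<le> N * \<bar>a\<bar>"
          using N by (intro mult_strict_right_mono mult_left_mono; linarith)+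
        moreover have "0 \<le> N * N" by simp
        moreover have "\<bar>a\<bar> * \<bar>a\<bar> \<le> 2 * (N * \<bar>a\<bar>) + 2 * (N * N)"
          using le that by (simp add: power2_eq_square mult_ac)
        ultimately show False by linarith
      qed
      moreover have Na: "N * \<bar>a\<bar> \<le> 4 * (N * N)" using mult_left_mono[OF a4 N] by simp
      moreover have "a * a + c \<le> 2 * (N * \<bar>a\<bar>) + 2 * (N * N)"
        using le by (simp add: power2_eq_square mult_ac)
      then have "c \<le> 10 * N^2"
        using Na zero_le_square[of a] unfolding power2_eq_square by linarith
      ultimately show False using False that by (auto simp: K_def cbox_Pair_eq)
    qed
    then show ?thesis by (simp add: f_def)
  qed
  have "m = 0"
  proof (rule ccontr)
    assume "m \<noteq> 0"
    then have mpos: "m > 0" unfolding m_def f_def z_def by auto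
    \<comment> \<open>The shift \<open>m / 2\<close> is strictly below \<open>m\<close>, as the
      shift lemma demands; minimality supplies the reverse inequality, so the step can be
      repeated.\<close>
    have all: "f (a0, c0 + real n * (m / 2)) = m" for n
    proof (induction n)
      case 0
      then show ?case by (simp add: m_def z_def)
    next
      case (Suc n)
      have "norm ((x - of_real a0)^2 + of_real (c0 + real n * (m / 2) + m / 2)) \<le> m"
        by (rule norm_quadratic_shift_le[OF min]) (use Suc mpos in \<open>simp_all add: f_def\<close>)
      moreover have "m \<le> norm ((x - of_real a0)^2 + of_real (c0 + real n * (m / 2) + m / 2))"
        by (rule min) (use c0 mpos in simp)
      moreover have "c0 + real n * (m / 2) + m / 2 = c0 + real (Suc n) * (m / 2)"
        by (simp add: field_simps)
      ultimately show ?case unfolding f_def by (simp only: case_prod_conv)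
    qed
    obtain n where "real n * (m / 2) > m + 2 * \<bar>a0\<bar> * N + N^2"
      using reals_Archimedean3[OF half_gt_zero[OF mpos]] by blast
    then show False using low[of a0 "c0 + real n * (m / 2)"] all[of n] c0 zero_le_power2[of a0] by linarith
  qed
  then have "(x - of_real a0)^2 + of_real c0 = 0" by (simp add: m_def z_def f_def)
  then show ?thesis using c0 by (metis real_sqrt_pow2)
qed

text \<open>The commutative Gelfand--Mazur theorem for multiplicative norms.\<close>
lemma real_normed_field_cases:
  obtains (real) "\<And>x::'k::real_normed_field. \<exists>a. x = of_real a"
  | (complex) j :: "'k::real_normed_field" where "j^2 = -1" "\<And>x::'k. \<exists>a b. x = of_real a + of_real b * j"
proof (cases "\<exists>j::'k. j^2 = -1")
  case False
  have "\<exists>a. x = of_real a" for x :: 'k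
  proof -
    obtain a b where ab: "(x - of_real a)^2 + of_real (b^2) = 0" using quadratic_root_exists by blast
    have "b = 0"
    proof (rule ccontr)
      assume "b \<noteq> 0"
      then have "((x - of_real a) / of_real b)^2 = -1"
        using ab by (simp add: power_divide eq_neg_iff_add_eq_0 field_simps)
      then show False using False by blast
    qed
    then show ?thesis using ab by auto
  qed
  then show ?thesis using real by blast
next
  case True
  then obtain j :: 'k where j: "j^2 = -1" by blast
  have "\<exists>a b. x = of_real a + of_real b * j" for x :: 'k
  proof -
    obtain a b where "(x - of_real a)^2 + of_real (b^2) = 0" using quadratic_root_exists by blast
    then have "(x - of_real a)^2 = (of_real b * j)^2" unfolding power_mult_distrib j by (simp add: eq_neg_iff_add_eq_0)
    then have "x - of_real a = of_real b * j \<or> x - of_real a = of_real (-b) * j"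
      by (simp add: power2_eq_iff)
    then show ?thesis by (metis add.commute diff_add_cancel)
  qed
  then show ?thesis using complex j by blast
qed


text \<open>The product of \<open>a + b * j\<close> and its conjugate is \<open>a^2 + b^2\<close>,
  which is at least half of \<open>(\<bar>a\<bar> + \<bar>b\<bar>)^2\<close>, and the conjugate has
  norm at most \<open>\<bar>a\<bar> + \<bar>b\<bar>\<close> since \<open>norm j = 1\<close>. Control
  of the coordinates gives both their uniqueness and the compactness of balls.\<close>

lemma norm_of_real_add_imaginary_ge:
  fixes j :: "'k::real_normed_field"
  assumes "j^2 = -1"
  shows "\<bar>a\<bar> + \<bar>b\<bar> \<le> 2 * norm (of_real a + of_real b * j)"
proof (cases "a = 0 \<and> b = 0")
  case False
  have "norm j ^ 2 = 1" using assms by (metis norm_power norm_minus_cancel norm_one)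
  then have j1: "norm j = 1" by (simp add: power2_eq_1_iff) (smt (verit) norm_ge_zero)
  have "of_real (a^2 + b^2) = (of_real a + of_real b * j) * (of_real a - of_real b * j)"
  proof -
    have "(of_real a + of_real b * j) * (of_real a - of_real b * j) = of_real a ^ 2 - of_real b ^ 2 * j ^ 2"
      by (simp add: algebra_simps power2_eq_square)
    then show ?thesis by (simp add: assms)
  qed
  then have "a^2 + b^2 = norm (of_real a + of_real b * j) * norm (of_real a - of_real b * j)"
    by (metis norm_mult norm_of_real abs_of_nonneg sum_power2_ge_zero)
  also have "\<dots> \<le> norm (of_real a + of_real b * j) * (\<bar>a\<bar> + \<bar>b\<bar>)"
    by (intro mult_left_mono order.trans[OF norm_triangle_ineq4]) (simp_all add: norm_mult j1)
  finally have 1: "a^2 + b^2 \<le> norm (of_real a + of_real b * j) * (\<bar>a\<bar> + \<bar>b\<bar>)" .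
  have "(\<bar>a\<bar> + \<bar>b\<bar>) * (\<bar>a\<bar> + \<bar>b\<bar>) \<le> 2 * (a^2 + b^2)"
    using zero_le_power2[of "\<bar>a\<bar> - \<bar>b\<bar>"] by (simp add: power2_eq_square algebra_simps)
  with 1 have "(\<bar>a\<bar> + \<bar>b\<bar>) * (\<bar>a\<bar> + \<bar>b\<bar>) \<le> (2 * norm (of_real a + of_real b * j)) * (\<bar>a\<bar> + \<bar>b\<bar>)"
    by (simp add: mult.assoc)
  moreover have "\<bar>a\<bar> + \<bar>b\<bar> > 0" using False by linarith
  ultimately show ?thesis by (metis mult_le_cancel_right_pos)
qed simp

lemma compact_cball_real_normed_field: "compact (cball (0::'k::real_normed_field) r)"
proof (cases rule: real_normed_field_cases[where 'k = 'k])
  case real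
  have "cball (0::'k) r \<subseteq> of_real ` {-r..r}"
  proof
    fix x :: 'k assume "x \<in> cball 0 r"
    moreover obtain a where "x = of_real a" using real by blast
    ultimately show "x \<in> of_real ` {-r..r}" by (auto simp: abs_le_iff)
  qed
  moreover have "compact (of_real ` {-r..r} :: 'k set)"
    by (intro compact_continuous_image continuous_intros) simp
  ultimately show ?thesis by (metis closed_cball compact_Int_closed inf.absorb_iff2)
next
  case (complex j)
  let ?f = "\<lambda>(a, b). of_real a + of_real b * j"
  have "cball (0::'k) r \<subseteq> ?f ` ({-2*r..2*r} \<times> {-2*r..2*r})"
  proof
    fix x :: 'k assume x: "x \<in> cball 0 r"
    obtain a b where ab: "x = of_real a + of_real b * j" using complex by blast
    have "\<bar>a\<bar> + \<bar>b\<bar> \<le> 2 * r"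
      using norm_of_real_add_imaginary_ge[OF complex(1), of a b] x by (simp add: ab)
    then show "x \<in> ?f ` ({-2*r..2*r} \<times> {-2*r..2*r})"
      by (intro image_eqI[of _ _ "(a, b)"]) (auto simp: ab)
  qed
  moreover have "compact (?f ` ({-2*r..2*r} \<times> {-2*r..2*r}))"
    unfolding case_prod_unfold by (intro compact_continuous_image continuous_intros compact_Times) simp_all
  ultimately show ?thesis by (metis closed_cball compact_Int_closed inf.absorb_iff2)
qed

text \<open>The two maps make \<open>re (cj x * y)\<close> a continuous real inner product, on which
  the closest-point argument for separation relies. For real scalars the conjugation is the
  identity.\<close>

lemma real_normed_field_conjugation:
  obtains re :: "'k::real_normed_field \<Rightarrow> real" and cj :: "'k \<Rightarrow> 'k"
  where "bounded_linear re" "bounded_linear cj"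
    "\<And>x y. re (cj x * y) = re (cj y * x)" "\<And>x. x \<noteq> 0 \<Longrightarrow> 0 < re (cj x * x)"
proof (cases rule: real_normed_field_cases[where 'k = 'k])
  case real
  then obtain re :: "'k \<Rightarrow> real" where re: "\<And>x. x = of_real (re x)" by metis
  have re': "re (of_real a) = a" for a using re[of "of_real a"] by simp
  have "bounded_linear re"
  proof (rule bounded_linear_intro[where K = 1])
    show "re (x + y) = re x + re y" for x y by (metis re re' of_real_add)
    show "re (r *\<^sub>R x) = r *\<^sub>R re x" for r x
      by (metis re re' of_real_mult scaleR_conv_of_real real_scaleR_def)
    show "norm (re x) \<le> norm x * 1" for x by (subst (2) re) simp
  qed
  moreover have "0 < re (id x * x)" if "x \<noteq> 0" for x
  proof -
    have "x * x = of_real (re x * re x)" by (metis re of_real_mult)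
    moreover have "re x \<noteq> 0" using that re[of x] by auto
    ultimately show ?thesis by (simp add: re' zero_less_mult_iff del: of_real_mult) linarith
  qed
  ultimately show ?thesis using that[of re id] by (simp add: mult.commute bounded_linear_ident id_def)
next
  case (complex j)
  from complex(2) obtain re im :: "'k \<Rightarrow> real"
    where ri: "\<And>x. x = of_real (re x) + of_real (im x) * j" by metis
  have uniq: "a = a' \<and> b = b'" if "of_real a + of_real b * j = of_real a' + of_real b' * j" for a a' b b'
  proof -
    have "of_real (a - a') + of_real (b - b') * j = 0" using that by (simp add: algebra_simps)
    then show ?thesis using norm_of_real_add_imaginary_ge[OF complex(1), of "a - a'" "b - b'"] by (simp del: of_real_diff) linarith
  qed
  have re': "re (of_real a + of_real b * j) = a" "im (of_real a + of_real b * j) = b" for a b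
    using uniq ri by metis+
  have jj: "j * j = -1" using complex(1) by (simp add: power2_eq_square)
  have add: "re (x + y) = re x + re y" "im (x + y) = im x + im y" for x y
  proof -
    have "x + y = of_real (re x + re y) + of_real (im x + im y) * j"
      by (subst ri[of x], subst ri[of y]) (simp add: algebra_simps)
    then show "re (x + y) = re x + re y" "im (x + y) = im x + im y" by (metis re')+
  qed
  have scale: "re (r *\<^sub>R x) = r * re x" "im (r *\<^sub>R x) = r * im x" for r x
  proof -
    have "r *\<^sub>R x = of_real (r * re x) + of_real (r * im x) * j"
      by (subst ri[of x]) (simp add: algebra_simps scaleR_conv_of_real)
    then show "re (r *\<^sub>R x) = r * re x" "im (r *\<^sub>R x) = r * im x" by (metis re')+
  qed
  have bd: "\<bar>re x\<bar> + \<bar>im x\<bar> \<le> 2 * norm x" for x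
    using norm_of_real_add_imaginary_ge[OF complex(1), of "re x" "im x"] ri[of x] by simp
  have blr: "bounded_linear re"
    by (rule bounded_linear_intro[where K = 2]) (use add scale in auto, smt (verit) bd real_norm_def)
  have bli: "bounded_linear im"
    by (rule bounded_linear_intro[where K = 2]) (use add scale in auto, smt (verit) bd real_norm_def)
  define cj where "cj = (\<lambda>x. of_real (re x) - of_real (im x) * j)"
  have "bounded_linear cj" unfolding cj_def
    by (intro bounded_linear_sub bounded_linear_mult_const
        bounded_linear_compose[OF bounded_linear_of_real blr] bounded_linear_compose[OF bounded_linear_of_real bli])
  moreover have ip: "re (cj x * y) = re x * re y + im x * im y" for x y
  proof -
    have "cj x * y = of_real (re x * re y + im x * im y) + of_real (re x * im y - im x * re y) * j"
    proof -
      have "cj x * y = (of_real (re x) - of_real (im x) * j) * (of_real (re y) + of_real (im y) * j)"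
        using ri[of y] by (simp add: cj_def)
      also have "\<dots> = of_real (re x * re y) - of_real (im x * im y) * (j * j) + of_real (re x * im y - im x * re y) * j"
        by (simp add: algebra_simps)
      finally show ?thesis by (simp add: jj)
    qed
    then show ?thesis by (metis re'(1))
  qed
  moreover have "0 < re (cj x * x)" if "x \<noteq> 0" for x
  proof -
    have "re x \<noteq> 0 \<or> im x \<noteq> 0" using that ri[of x] by auto
    then show ?thesis unfolding ip by (metis power2_eq_square sum_power2_gt_zero_iff)
  qed
  ultimately show ?thesis using that[of re cj] blr by (simp add: mult.commute)
qed

section \<open>Hausdorff distance and hyperspaces\<close>

text \<open>The distance is a parameter so that one theory covers both \<open>frakdH\<close>, built
  on \<open>polar_metric\<close>, and \<open>dHA\<close>, built on the difference of evaluations at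
  a vector.\<close>

definition hausdorff_dist :: "('b \<Rightarrow> 'b \<Rightarrow> real) \<Rightarrow> 'b set \<Rightarrow> 'b set \<Rightarrow> real" where
  "hausdorff_dist \<rho> F G = max (SUP x\<in>F. INF y\<in>G. \<rho> x y) (SUP y\<in>G. INF x\<in>F. \<rho> x y)"

text \<open>Only a pseudometric, because evaluation at one vector need not separate functionals. The
  bound \<open>C\<close> keeps the real-valued suprema in \<open>hausdorff_dist\<close>
  meaningful.\<close>

locale bounded_pseudometric =
  fixes P :: "'b set" and \<rho> :: "'b \<Rightarrow> 'b \<Rightarrow> real" and C :: real
  assumes pos: "x \<in> P \<Longrightarrow> y \<in> P \<Longrightarrow> 0 \<le> \<rho> x y"
    and refl: "x \<in> P \<Longrightarrow> \<rho> x x = 0"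
    and sym: "x \<in> P \<Longrightarrow> y \<in> P \<Longrightarrow> \<rho> x y = \<rho> y x"
    and tri: "x \<in> P \<Longrightarrow> y \<in> P \<Longrightarrow> z \<in> P \<Longrightarrow> \<rho> x z \<le> \<rho> x y + \<rho> y z"
    and bound: "x \<in> P \<Longrightarrow> y \<in> P \<Longrightarrow> \<rho> x y \<le> C"
begin

lemma bdd_below_dist:
  assumes "F \<subseteq> P" "y \<in> P"
  shows "bdd_below ((\<lambda>x. \<rho> x y) ` F)" "bdd_below (\<rho> y ` F)"
  using assms pos by (auto intro!: bdd_belowI2[where m = 0])

lemma hausdorff_dist_sym:
  assumes "F \<subseteq> P" "G \<subseteq> P"
  shows "hausdorff_dist \<rho> F G = hausdorff_dist \<rho> G F"
proof -
  have "(SUP x\<in>F. INF y\<in>G. \<rho> x y) = (SUP x\<in>F. INF y\<in>G. \<rho> y x)"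
    if "F \<subseteq> P" "G \<subseteq> P" for F G
    using that by (intro SUP_cong INF_cong refl sym) auto
  then show ?thesis using assms by (simp add: hausdorff_dist_def max.commute)
qed

lemma hausdorff_dist_leI:
  assumes "F \<noteq> {}" "F \<subseteq> P" "G \<noteq> {}" "G \<subseteq> P"
    and "\<And>x. x \<in> F \<Longrightarrow> \<exists>y\<in>G. \<rho> x y \<le> r" "\<And>y. y \<in> G \<Longrightarrow> \<exists>x\<in>F. \<rho> x y \<le> r"
  shows "hausdorff_dist \<rho> F G \<le> r"
proof -
  have "(SUP x\<in>F. INF y\<in>G. \<rho> x y) \<le> r"
  proof (rule cSUP_least)
    fix x assume "x \<in> F"
    then obtain y where y: "y \<in> G" "\<rho> x y \<le> r" using assms by blast
    then show "(INF y\<in>G. \<rho> x y) \<le> r"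
      using \<open>x \<in> F\<close> assms by (intro cINF_lower2[where x = y] bdd_below_dist) auto
  qed fact
  moreover have "(SUP y\<in>G. INF x\<in>F. \<rho> x y) \<le> r"
  proof (rule cSUP_least)
    fix y assume "y \<in> G"
    then obtain x where x: "x \<in> F" "\<rho> x y \<le> r" using assms by blast
    then show "(INF x\<in>F. \<rho> x y) \<le> r"
      using \<open>y \<in> G\<close> assms by (intro cINF_lower2[where x = x] bdd_below_dist) auto
  qed fact
  ultimately show ?thesis by (simp add: hausdorff_dist_def)
qed

text \<open>Infima need not be attained, so a witness is extracted from a strict bound;
  \<open>hausdorff_dist_leI\<close> goes back with non-strict ones.\<close>

lemma hausdorff_dist_lessD:
  assumes "F \<subseteq> P" "G \<noteq> {}" "G \<subseteq> P" "hausdorff_dist \<rho> F G < r" "x \<in> F"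
  obtains y where "y \<in> G" "\<rho> x y < r"
proof -
  have "bdd_above ((\<lambda>x. INF y\<in>G. \<rho> x y) ` F)"
  proof (rule bdd_aboveI2)
    fix x assume "x \<in> F"
    obtain y where y: "y \<in> G" using assms by blast
    show "(INF y\<in>G. \<rho> x y) \<le> C"
      using \<open>x \<in> F\<close> y assms by (intro cINF_lower2[where x = y] bdd_below_dist bound) auto
  qed
  then have "(INF y\<in>G. \<rho> x y) \<le> (SUP x\<in>F. INF y\<in>G. \<rho> x y)" using assms(5) by (intro cSUP_upper) auto
  also have "\<dots> < r" using assms(4) by (simp add: hausdorff_dist_def)
  finally show thesis
    using that assms(1,2,5) bdd_below_dist(2)[OF assms(3), of x] by (subst (asm) cINF_less_iff) auto
qed

lemma hausdorff_dist_ge_dist_set: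
  assumes "F \<noteq> {}" "F \<subseteq> P" "G \<noteq> {}" "G \<subseteq> P" "x \<in> F" "\<And>y. y \<in> G \<Longrightarrow> r \<le> \<rho> x y"
  shows "r \<le> hausdorff_dist \<rho> F G"
  using assms by (meson hausdorff_dist_lessD linorder_not_le)

lemma hausdorff_dist_nonneg:
  assumes "F \<noteq> {}" "F \<subseteq> P" "G \<noteq> {}" "G \<subseteq> P"
  shows "0 \<le> hausdorff_dist \<rho> F G"
  using assms pos hausdorff_dist_ge_dist_set by (metis all_not_in_conv subsetD)

lemma hausdorff_dist_refl:
  assumes "F \<noteq> {}" "F \<subseteq> P"
  shows "hausdorff_dist \<rho> F F = 0"
  using assms refl by (intro antisym hausdorff_dist_nonneg hausdorff_dist_leI) (auto intro!: bexI)

text \<open>The same witnesses serve both distances. The additive \<open>e\<close> leaves room for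
  evaluation at a vector that is only approximated by the dense sequence.\<close>

lemma hausdorff_dist_bounded_comparison:
  assumes cmp: "\<And>x y. x \<in> P \<Longrightarrow> y \<in> P \<Longrightarrow> \<rho>' x y \<le> e + K * \<rho> x y" and K: "K \<ge> 0"
    and ps: "bounded_pseudometric P \<rho>' C'"
    and F: "F \<noteq> {}" "F \<subseteq> P" and G: "G \<noteq> {}" "G \<subseteq> P"
    and less: "hausdorff_dist \<rho> F G < r"
  shows "hausdorff_dist \<rho>' F G \<le> e + K * r"
proof -
  have *: "\<exists>y\<in>G. \<rho>' x y \<le> e + K * r"
    if prem: "F \<subseteq> P" "G \<noteq> {}" "G \<subseteq> P" "hausdorff_dist \<rho> F G < r" "x \<in> F" for F G x
  proof -
    obtain y where y: "y \<in> G" "\<rho> x y < r" by (rule hausdorff_dist_lessD[OF prem])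
    then have "\<rho>' x y \<le> e + K * \<rho> x y" using prem cmp by blast
    also have "\<dots> \<le> e + K * r" using y K by (simp add: mult_left_mono)
    finally show ?thesis using y by blast
  qed
  have "\<exists>x\<in>F. \<rho>' x y \<le> e + K * r" if "y \<in> G" for y
    using *[of G F y] F G that hausdorff_dist_sym less bounded_pseudometric.sym[OF ps]
    by (smt (verit) subsetD)
  then show ?thesis
    using *[of F G] F G less by (intro bounded_pseudometric.hausdorff_dist_leI[OF ps]) auto
qed

text \<open>Optimal points may not exist, so points with slack \<open>e/2\<close> are chained
  through \<open>G\<close>, and the total slack \<open>e\<close> is removed at the end.\<close>

lemma hausdorff_dist_triangle:
  assumes F: "F \<noteq> {}" "F \<subseteq> P" and G: "G \<noteq> {}" "G \<subseteq> P" and H: "H \<noteq> {}" "H \<subseteq> P"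
  shows "hausdorff_dist \<rho> F H \<le> hausdorff_dist \<rho> F G + hausdorff_dist \<rho> G H"
proof (rule field_le_epsilon)
  fix e :: real assume e: "e > 0"
  let ?s = "hausdorff_dist \<rho> F G + hausdorff_dist \<rho> G H + e"
  have *: "\<exists>z\<in>H. \<rho> x z \<le> hausdorff_dist \<rho> F G + hausdorff_dist \<rho> G H + e"
    if prem: "F \<subseteq> P" "H \<noteq> {}" "H \<subseteq> P" "x \<in> F" for F H x
  proof -
    obtain y where y: "y \<in> G" "\<rho> x y < hausdorff_dist \<rho> F G + e/2"
      using hausdorff_dist_lessD[OF prem(1) G _ prem(4), of "hausdorff_dist \<rho> F G + e/2"] e by auto
    obtain z where z: "z \<in> H" "\<rho> y z < hausdorff_dist \<rho> G H + e/2"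
      using hausdorff_dist_lessD[OF G(2) prem(2,3) _ y(1), of "hausdorff_dist \<rho> G H + e/2"] e by auto
    have "\<rho> x z \<le> \<rho> x y + \<rho> y z" using y z prem G by (intro tri) auto
    then show ?thesis using y z by (intro bexI[of _ z]) auto
  qed
  have "\<exists>x\<in>F. \<rho> x z \<le> ?s" if "z \<in> H" for z
    using *[of H F z] F H G that hausdorff_dist_sym sym by (smt (verit) subsetD)
  then show "hausdorff_dist \<rho> F H \<le> ?s"
    using *[of F H] F H by (intro hausdorff_dist_leI) auto
qed

end

text \<open>The locale \<open>Metric_space\<close> demands nonnegativity and symmetry also outside the carrier, where
  suprema and series are junk; hence the restriction.\<close>
definition restrict_dist :: "'b set \<Rightarrow> ('b \<Rightarrow> 'b \<Rightarrow> real) \<Rightarrow> 'b \<Rightarrow> 'b \<Rightarrow> real" where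
  "restrict_dist P \<rho> x y = (if x \<in> P \<and> y \<in> P then \<rho> x y else 0)"

lemma hausdorff_dist_restrict_dist:
  assumes "F \<subseteq> P" "G \<subseteq> P"
  shows "hausdorff_dist (restrict_dist P \<rho>) F G = hausdorff_dist \<rho> F G"
  unfolding hausdorff_dist_def
  by (intro arg_cong2[where f = max] SUP_cong INF_cong) (use assms in \<open>auto simp: restrict_dist_def\<close>)

lemma (in bounded_pseudometric) Metric_space_restrict_dist:
  assumes "Q \<subseteq> P" "\<And>x y. x \<in> Q \<Longrightarrow> y \<in> Q \<Longrightarrow> \<rho> x y = 0 \<Longrightarrow> x = y"
  shows "Metric_space Q (restrict_dist Q \<rho>)"
  by unfold_locales (use assms pos refl sym tri in \<open>auto simp: restrict_dist_def subset_iff\<close>)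

context Metric_space
begin

lemma closedin_mtopology_iff_adherent:
  "closedin mtopology F \<longleftrightarrow> F \<subseteq> M \<and> (\<forall>x\<in>M. (\<forall>e>0. \<exists>y\<in>F. d x y < e) \<longrightarrow> x \<in> F)"
  unfolding closedin_metric by (auto simp: disjnt_iff Ball_def Bex_def subset_iff) (metis not_less)+

lemma compact_space_bounded_pseudometric:
  assumes "compact_space mtopology"
  obtains C where "bounded_pseudometric M d C"
proof -
  have "mbounded M" using assms by (simp add: compact_space_def compactin_imp_mbounded)
  then obtain C where "\<And>x y. x \<in> M \<Longrightarrow> y \<in> M \<Longrightarrow> d x y \<le> C" by (auto simp: mbounded_alt)
  then have "bounded_pseudometric M d C"
    by unfold_locales (auto simp: commute intro: triangle)
  then show thesis by (rule that)
qed

section \<open>Nonempty closed subsets of a compact metric space under the Hausdorff metric\<close>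

definition closed_hyperspace :: "'a set set" where
  "closed_hyperspace = {F. F \<noteq> {} \<and> closedin mtopology F}"

abbreviation hyper_dist :: "'a set \<Rightarrow> 'a set \<Rightarrow> real" where
  "hyper_dist \<equiv> restrict_dist closed_hyperspace (hausdorff_dist d)"

lemma closed_hyperspaceD:
  assumes "F \<in> closed_hyperspace"
  shows "F \<noteq> {}" "F \<subseteq> M" "x \<in> M \<Longrightarrow> (\<And>e. e > 0 \<Longrightarrow> \<exists>y\<in>F. d x y < e) \<Longrightarrow> x \<in> F"
  using assms by (auto simp: closed_hyperspace_def closedin_mtopology_iff_adherent)

lemma Metric_space_closed_hyperspace:
  assumes "bounded_pseudometric M d C"
  shows "Metric_space closed_hyperspace hyper_dist"
proof -
  interpret b: bounded_pseudometric M d C by fact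
  have sub: "F \<subseteq> G" if FG: "F \<in> closed_hyperspace" "G \<in> closed_hyperspace" and "hausdorff_dist d F G = 0" for F G
  proof
    fix x assume "x \<in> F"
    moreover have "\<exists>y\<in>G. d x y < e" if "e > 0" for e
      using b.hausdorff_dist_lessD[OF closed_hyperspaceD(2)[OF FG(1)] closed_hyperspaceD(1,2)[OF FG(2)] _ \<open>x \<in> F\<close>, of e]
        that \<open>hausdorff_dist d F G = 0\<close> by auto
    ultimately show "x \<in> G" using closed_hyperspaceD FG by blast
  qed
  show ?thesis
  proof
    fix F G
    show "0 \<le> hyper_dist F G"
      using b.hausdorff_dist_nonneg closed_hyperspaceD by (auto simp: restrict_dist_def)
    show sym: "hyper_dist F G = hyper_dist G F"
      using b.hausdorff_dist_sym closed_hyperspaceD(2) by (auto simp: restrict_dist_def)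
    assume FG: "F \<in> closed_hyperspace" "G \<in> closed_hyperspace"
    show "hyper_dist F G = 0 \<longleftrightarrow> F = G"
      using FG sub[of F G] sub[of G F] sym b.hausdorff_dist_refl closed_hyperspaceD(1,2)
      by (auto simp: restrict_dist_def)
  next
    fix F G H assume "F \<in> closed_hyperspace" "G \<in> closed_hyperspace" "H \<in> closed_hyperspace"
    then show "hyper_dist F H \<le> hyper_dist F G + hyper_dist G H"
      using b.hausdorff_dist_triangle closed_hyperspaceD(1,2) by (simp add: restrict_dist_def)
  qed
qed

text \<open>Up to \<open>2*e/3\<close>, a closed set is determined by which points of a finite
  \<open>e/3\<close>-net lie within \<open>e/3\<close> of it. There are finitely many such patterns,
  and one representative of each suffices.\<close>

lemma mtotally_bounded_closed_hyperspace:
  assumes "compact_space mtopology"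
  shows "Metric_space.mtotally_bounded closed_hyperspace hyper_dist closed_hyperspace"
proof -
  obtain C where "bounded_pseudometric M d C" using compact_space_bounded_pseudometric assms by blast
  interpret b: bounded_pseudometric M d C by fact
  interpret h: Metric_space closed_hyperspace hyper_dist
    by (rule Metric_space_closed_hyperspace) fact
  show ?thesis unfolding h.mtotally_bounded_def
  proof (intro allI impI)
    fix e :: real assume e: "e > 0"
    have "mtotally_bounded M" using assms by (simp add: compact_space_eq_mcomplete_mtotally_bounded)
    then obtain N where N: "finite N" "N \<subseteq> M" "M \<subseteq> (\<Union>x\<in>N. mball x (e/3))"
      unfolding mtotally_bounded_def using e by (metis zero_less_divide_iff zero_less_numeral)
    define pat where "pat F = {p\<in>N. \<exists>x\<in>F. d p x < e/3}" for F
    define K where "K = inv_into closed_hyperspace pat ` (pat ` closed_hyperspace)"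
    have "finite (pat ` closed_hyperspace)"
      by (rule finite_subset[of _ "Pow N"]) (use N in \<open>auto simp: pat_def\<close>)
    then have "finite K" by (simp add: K_def)
    moreover have K: "K \<subseteq> closed_hyperspace" by (auto simp: K_def intro: inv_into_into)
    moreover have "F \<in> (\<Union>G\<in>K. h.mball G e)" if F: "F \<in> closed_hyperspace" for F
    proof -
      define G where "G = inv_into closed_hyperspace pat (pat F)"
      have G: "G \<in> K" using F by (auto simp: K_def G_def)
      then have GH: "G \<in> closed_hyperspace" using K by blast
      have "pat G = pat F" using F unfolding G_def by (intro f_inv_into_f) auto
      have near: "\<exists>y\<in>G. d x y \<le> 2*e/3" if prem: "pat F = pat G" "x \<in> F" "F \<in> closed_hyperspace" "G \<in> closed_hyperspace" for F G x
      proof -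
        have "x \<in> M" using prem closed_hyperspaceD(2) by blast
        then obtain p where p: "p \<in> N" "d p x < e/3" using N(3) by auto
        then have "p \<in> pat G" using prem by (auto simp: pat_def)
        then obtain y where y: "y \<in> G" "d p y < e/3" by (auto simp: pat_def)
        have "y \<in> M" "p \<in> M" using y p N prem closed_hyperspaceD(2) by blast+
        then have "d x y \<le> d p x + d p y" using \<open>x \<in> M\<close> by (metis commute triangle)
        then show ?thesis using p y by (intro bexI[of _ y]) auto
      qed
      have "hausdorff_dist d G F \<le> 2*e/3"
        using near[of G F] near[of F G] \<open>pat G = pat F\<close> F GH
        by (intro b.hausdorff_dist_leI closed_hyperspaceD(1,2)) (auto simp: commute)
      then show ?thesis using F GH G e by (intro UN_I[OF G]) (simp add: restrict_dist_def)
    qed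
    ultimately show "\<exists>K. finite K \<and> K \<subseteq> closed_hyperspace \<and> closed_hyperspace \<subseteq> (\<Union>G\<in>K. h.mball G e)"
      by blast
  qed
qed

text \<open>The limit consists of the points that the sets \<open>S n\<close> eventually approach.
  Its points are near \<open>S n\<close> by the Cauchy property; that points of \<open>S n\<close>
  are near the limit needs compactness, which supplies points of the limit in the first place. In
  both estimates the index is independent of the point.\<close>

lemma mcomplete_closed_hyperspace:
  assumes "compact_space mtopology"
  shows "Metric_space.mcomplete closed_hyperspace hyper_dist"
proof -
  obtain C where "bounded_pseudometric M d C" using compact_space_bounded_pseudometric assms by blast
  interpret b: bounded_pseudometric M d C by fact
  interpret h: Metric_space closed_hyperspace hyper_dist
    by (rule Metric_space_closed_hyperspace) fact
  show ?thesis unfolding h.mcomplete_def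
  proof (intro allI impI)
    fix S assume S: "h.MCauchy S"
    then have SH: "S n \<in> closed_hyperspace" for n by (auto simp: h.MCauchy_def)
    note SD = closed_hyperspaceD[OF SH]
    have Cau: "\<exists>N. \<forall>m\<ge>N. \<forall>n\<ge>N. \<forall>x\<in>S m. \<exists>y\<in>S n. d x y < e" if e: "e > 0" for e
    proof -
      obtain N where N: "\<And>m n. N \<le> m \<Longrightarrow> N \<le> n \<Longrightarrow> hyper_dist (S m) (S n) < e"
        using S e unfolding h.MCauchy_def by blast
      have "\<forall>x\<in>S m. \<exists>y\<in>S n. d x y < e" if "m \<ge> N" "n \<ge> N" for m n
      proof
        fix x assume "x \<in> S m"
        moreover have "hausdorff_dist d (S m) (S n) < e"
          using N[OF that] SH by (simp add: restrict_dist_def)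
        ultimately show "\<exists>y\<in>S n. d x y < e"
          using b.hausdorff_dist_lessD[OF SD(2) SD(1,2)] by metis
      qed
      then show ?thesis by blast
    qed
    define L where "L = {x\<in>M. \<forall>e>0. \<forall>\<^sub>F n in sequentially. \<exists>y\<in>S n. d x y < e}"
    have LM: "L \<subseteq> M" by (auto simp: L_def)
    \<comment> \<open>A point of \<open>L\<close> is near some late \<open>S m\<close>, which in
      turn is near \<open>S n\<close>; hence the factor 2.\<close>
    have to: "\<exists>y\<in>S n. d x y < 2 * e" 
      if N: "\<forall>m\<ge>N. \<forall>n\<ge>N. \<forall>x\<in>S m. \<exists>y\<in>S n. d x y < e" and prem: "e > 0" "n \<ge> N" "x \<in> L" for N e n x
    proof -
      have "\<forall>\<^sub>F n in sequentially. \<exists>y\<in>S n. d x y < e" using prem by (simp add: L_def)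
      then have "\<forall>\<^sub>F n in sequentially. N \<le> n \<and> (\<exists>y\<in>S n. d x y < e)"
        using eventually_ge_at_top by (rule eventually_conj[rotated])
      then obtain m where m: "m \<ge> N" "\<exists>y\<in>S m. d x y < e"
        using eventually_happens'[OF sequentially_bot] by blast
      obtain y where y: "y \<in> S m" "d x y < e" using m(2) by blast
      obtain z where z: "z \<in> S n" "d y z < e" using N m(1) prem(2) y(1) by blast
      have "x \<in> M" "y \<in> M" "z \<in> M" using y z SD(2) prem LM by blast+
      then have "d x z < 2 * e" using triangle[of x y z] y z by linarith
      then show ?thesis using z by blast
    qed
    have fromL: "\<exists>y\<in>L. d x y \<le> e"
      if N: "\<forall>m\<ge>N. \<forall>n\<ge>N. \<forall>x\<in>S m. \<exists>y\<in>S n. d x y < e" and prem: "e > 0" "n \<ge> N" "x \<in> S n" for N e n x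
    proof -
      have xM: "x \<in> M" using SD(2) prem by blast
      \<comment> \<open>The point \<open>x\<close> is tracked through all sets from index
        \<open>N\<close> on; a cluster point of the tracks is the candidate in
        \<open>L\<close>.\<close>
      have "\<forall>m. \<exists>y. y \<in> S (N + m) \<and> d x y < e" using N prem by (meson le_add1)
      then obtain t where t: "\<And>m. t m \<in> S (N + m)" "\<And>m. d x (t m) < e" by metis
      have tM: "t m \<in> M" for m using t(1) SD(2) by blast
      then obtain l r where l: "l \<in> M" "strict_mono r" "limitin mtopology (t \<circ> r) l sequentially"
        using assms unfolding compact_space_sequentially by (metis image_subsetI)
      have conv: "\<exists>K. \<forall>k\<ge>K. d (t (r k)) l < \<eta>" if "\<eta> > 0" for \<eta>
        using l(3) that by (force simp: limit_metric_sequentially)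
      have "l \<in> L" unfolding L_def
      proof (safe intro!: l(1))
        fix \<eta> :: real assume "\<eta> > 0"
        obtain N' where N': "\<forall>m\<ge>N'. \<forall>n\<ge>N'. \<forall>x\<in>S m. \<exists>y\<in>S n. d x y < \<eta>/2"
          using Cau[OF half_gt_zero[OF \<open>\<eta> > 0\<close>]] by blast
        obtain K where K: "\<And>k. k \<ge> K \<Longrightarrow> d (t (r k)) l < \<eta>/2" using conv[OF half_gt_zero[OF \<open>\<eta> > 0\<close>]] by blast
        \<comment> \<open>Only a subsequence of \<open>t\<close> converges, but one late term
          suffices: the Cauchy property carries its closeness to \<open>l\<close> over to every
          \<open>S n\<close> with \<open>n \<ge> N'\<close>. Its index is late enough because
          \<open>r k \<ge> k\<close>.\<close>
        define k where "k = max K N'"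
        have k: "N + r k \<ge> N'" using l(2) seq_suble[of r k] by (simp add: k_def)
        have "\<exists>y\<in>S n. d l y < \<eta>" if n: "n \<ge> N'" for n
        proof -
          obtain y where y: "y \<in> S n" "d (t (r k)) y < \<eta>/2" using N' k n t(1) by blast
          have "y \<in> M" using y SD(2) by blast
          then have "d l y \<le> d (t (r k)) l + d (t (r k)) y" using l(1) tM by (metis commute triangle)
          then show ?thesis using y K[of k] by (intro bexI[of _ y]) (auto simp: k_def)
        qed
        then show "\<forall>\<^sub>F n in sequentially. \<exists>y\<in>S n. d l y < \<eta>"
          unfolding eventually_sequentially by blast
      qed
      moreover have "d x l \<le> e"
      proof (rule field_le_epsilon)
        fix \<eta> :: real assume "\<eta> > 0"
        then obtain k where "d (t (r k)) l < \<eta>" using conv by blast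
        then show "d x l \<le> e + \<eta>" using triangle[OF xM tM l(1), of "r k"] t(2)[of "r k"] by linarith
      qed
      ultimately show ?thesis by blast
    qed
    have "L \<noteq> {}"
    proof -
      obtain N where N: "\<forall>m\<ge>N. \<forall>n\<ge>N. \<forall>x\<in>S m. \<exists>y\<in>S n. d x y < 1" using Cau[of 1] by auto
      moreover obtain x where "x \<in> S N" using SD(1) by blast
      ultimately show ?thesis using fromL[OF N] by fastforce
    qed
    moreover have "closedin mtopology L" unfolding closedin_mtopology_iff_adherent
    proof (intro conjI LM ballI impI)
      fix x assume x: "x \<in> M" "\<forall>e>0. \<exists>y\<in>L. d x y < e"
      have "\<forall>\<^sub>F n in sequentially. \<exists>z\<in>S n. d x z < e" if e: "e > 0" for e
      proof -
        obtain y where y: "y \<in> L" "d x y < e/2" using x e by (meson half_gt_zero)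
        then have "\<forall>\<^sub>F n in sequentially. \<exists>z\<in>S n. d y z < e/2"
          using half_gt_zero[OF e] unfolding L_def by blast
        then show ?thesis
        proof eventually_elim
          case (elim n)
          then obtain z where z: "z \<in> S n" "d y z < e/2" by blast
          then have "d x z \<le> d x y + d y z" using x y LM SD(2) by (intro triangle) auto
          then show ?case using y z by (intro bexI[of _ z]) auto
        qed
      qed
      then show "x \<in> L" using x by (simp add: L_def)
    qed
    ultimately have LH: "L \<in> closed_hyperspace" by (simp add: closed_hyperspace_def)
    have "\<exists>N. \<forall>n\<ge>N. hyper_dist (S n) L < e" if e: "e > 0" for e
    proof -
      obtain N where N: "\<forall>m\<ge>N. \<forall>n\<ge>N. \<forall>x\<in>S m. \<exists>y\<in>S n. d x y < e/3" using Cau[of "e/3"] \<open>e > 0\<close> by auto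
      have "hausdorff_dist d (S n) L \<le> 2 * (e/3)" if "n \<ge> N" for n
      proof (intro b.hausdorff_dist_leI SD(1,2) closed_hyperspaceD(1,2)[OF LH])
        show "\<exists>y\<in>L. d x y \<le> 2 * (e/3)" if "x \<in> S n" for x
          using fromL[OF N _ \<open>n \<ge> N\<close> that] \<open>e > 0\<close> by (force intro: order.trans)
        show "\<exists>x\<in>S n. d x y \<le> 2 * (e/3)" if "y \<in> L" for y
          using to[OF N _ \<open>n \<ge> N\<close> that] \<open>e > 0\<close> by (metis commute less_imp_le zero_less_divide_iff zero_less_numeral)
      qed
      then show ?thesis using e LH SH by (intro exI[of _ N]) (fastforce simp: restrict_dist_def intro: le_less_trans)
    qed
    then have "limitin h.mtopology S L sequentially"
      using LH SH by (simp add: h.limit_metric_sequentially)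
    then show "\<exists>L. limitin h.mtopology S L sequentially" by blast
  qed
qed

theorem compact_space_closed_hyperspace:
  assumes "compact_space mtopology"
  shows "compact_space (Metric_space.mtopology closed_hyperspace hyper_dist)"
proof -
  obtain C where "bounded_pseudometric M d C" using compact_space_bounded_pseudometric assms by blast
  then interpret h: Metric_space closed_hyperspace hyper_dist by (rule Metric_space_closed_hyperspace)
  show ?thesis
    using mtotally_bounded_closed_hyperspace mcomplete_closed_hyperspace assms
    by (simp add: h.compact_space_eq_mcomplete_mtotally_bounded)
qed

end

section \<open>The polar of a neighbourhood of zero\<close>

locale tvs_polar =
  fixes smul :: "'k::real_normed_field \<Rightarrow> 'a::ab_group_add \<Rightarrow> 'a"
    and T :: "'a topology" and U :: "'a set" and A :: "nat \<Rightarrow> 'a"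
  assumes tvs: "tvs smul T" and nhd: "zero_nhd T U" and dense: "T closure_of (range A) = UNIV"
begin

abbreviation P :: "('a \<Rightarrow> 'k) set" where "P \<equiv> polar smul T U"
abbreviation pd :: "('a \<Rightarrow> 'k) \<Rightarrow> ('a \<Rightarrow> 'k) \<Rightarrow> real" where "pd \<equiv> polar_metric smul T U A"

sublocale vector_space smul using tvs by (simp add: tvs_def)

text \<open>For \<open>0 \<in> V\<close> and nonzero \<open>c\<close> this is a neighbourhood of
  \<open>x\<close> on which linear functionals bounded by 1 on \<open>V\<close> stay within
  \<open>1 / norm c\<close> of their value at \<open>x\<close>. It yields continuity of one
  functional and equicontinuity of the polar.\<close>

lemma openin_preimage_scaled_translate:
  assumes "openin T V"
  shows "openin T {y. smul c (y - x) \<in> V}"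
proof -
  have top: "topspace T = UNIV" using tvs by (simp add: tvs_def)
  have smul: "continuous_map (prod_topology euclidean T) T (\<lambda>(c, x). smul c x)"
    and add: "continuous_map (prod_topology T T) T (\<lambda>(x, y). x + y)"
    using tvs by (simp_all add: tvs_def)
  have "continuous_map T (prod_topology T T) (\<lambda>y. (y, - x))"
    by (simp add: continuous_map_pairwise o_def top)
  then have "continuous_map T T (\<lambda>y. y - x)"
    using continuous_map_compose[OF _ add] by (fastforce simp: o_def)
  then have "continuous_map T (prod_topology euclidean T) (\<lambda>y. (c, y - x))"
    by (simp add: continuous_map_pairwise o_def)
  then have "continuous_map T T (\<lambda>y. smul c (y - x))"
    using continuous_map_compose[OF _ smul] by (fastforce simp: o_def)
  then show ?thesis using assms by (auto simp: continuous_map_def top)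
qed

lemma absorbing:
  assumes "openin T V" "0 \<in> V"
  obtains t :: real where "t > 0" "smul (of_real t) x \<in> V"
proof -
  have top: "topspace T = UNIV" using tvs by (simp add: tvs_def)
  have smul: "continuous_map (prod_topology euclidean T) T (\<lambda>(c, x). smul c x)"
    using tvs by (simp add: tvs_def)
  have "continuous_map euclidean (prod_topology euclidean T) (\<lambda>c. (c, x))"
    by (simp add: continuous_map_pairwise o_def top)
  then have "continuous_map euclidean T (\<lambda>c. smul c x)"
    using continuous_map_compose[OF _ smul] by (fastforce simp: o_def)
  then have "open {c. smul c x \<in> V}" using assms(1) by (auto simp: continuous_map_def)
  moreover have "0 \<in> {c. smul c x \<in> V}" using assms(2) by simp
  ultimately obtain e where e: "e > 0" "\<And>c. dist c 0 < e \<Longrightarrow> smul c x \<in> V"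
    by (metis (mono_tags, lifting) mem_Collect_eq open_dist)
  show thesis by (rule that[of "e/2"]) (use e in simp_all)
qed

lemma zero_nhdE:
  obtains V where "openin T V" "0 \<in> V" "V \<subseteq> U"
  using nhd by (auto simp: zero_nhd_def)

lemma linear_functional_iff:
  "Vector_Spaces.linear smul (*) \<sigma> \<longleftrightarrow> (\<forall>x y. \<sigma> (x + y) = \<sigma> x + \<sigma> y) \<and> (\<forall>c x. \<sigma> (smul c x) = c * \<sigma> x)"
proof -
  have "vector_space ((*) :: 'k \<Rightarrow> _)" by unfold_locales (simp_all add: algebra_simps)
  then show ?thesis using vector_space_axioms by (simp add: Vector_Spaces.linear_iff)
qed

text \<open>Linearity appears as raw equations rather than as membership in the polar, because the
  bound is used to prove \<open>mem_polar_iff\<close>, where continuity is still open.\<close>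

lemma norm_functional_le:
  assumes "\<forall>x y. \<sigma> (x + y) = \<sigma> x + \<sigma> y" "\<forall>c x. \<sigma> (smul c x) = c * \<sigma> x"
    "\<forall>x\<in>U. norm (\<sigma> x :: 'k) \<le> 1" "t > 0" "smul (of_real t) z \<in> U"
  shows "norm (\<sigma> z) \<le> 1 / t"
proof -
  have "norm (\<sigma> (smul (of_real t) z)) \<le> 1" using assms by blast
  then show ?thesis using assms by (simp add: norm_mult field_simps)
qed

text \<open>Continuity is automatic for a linear functional bounded on a neighbourhood of zero.\<close>
lemma mem_polar_iff:
  "\<sigma> \<in> P \<longleftrightarrow> (\<forall>x y. \<sigma> (x + y) = \<sigma> x + \<sigma> y) \<and> (\<forall>c x. \<sigma> (smul c x) = c * \<sigma> x) \<and> (\<forall>x\<in>U. norm (\<sigma> x) \<le> 1)"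
    (is "_ \<longleftrightarrow> ?rhs")
proof
  show ?rhs if "\<sigma> \<in> P" using that by (simp add: polar_def tdual_def linear_functional_iff)
  assume r: ?rhs
  have top: "topspace T = UNIV" using tvs by (simp add: tvs_def)
  obtain V where V: "openin T V" "0 \<in> V" "V \<subseteq> U" by (rule zero_nhdE)
  have diff: "\<sigma> (y - x) = \<sigma> y - \<sigma> x" for x y
    using r by (metis add_diff_cancel_right' diff_add_cancel)
  have "openin T {x. \<sigma> x \<in> W}" if "open W" for W
  proof (subst openin_subopen, safe)
    fix x assume "\<sigma> x \<in> W"
    then obtain e where e: "e > 0" "\<And>y. dist y (\<sigma> x) < e \<Longrightarrow> y \<in> W" using \<open>open W\<close> by (metis open_dist)
    let ?N = "{y. smul (of_real (2/e)) (y - x) \<in> V}"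
    have "\<sigma> y \<in> W" if "y \<in> ?N" for y
    proof -
      have "norm (\<sigma> (y - x)) \<le> 1 / (2/e)"
        by (rule norm_functional_le) (use r e V that in auto)
      then show ?thesis using e by (intro e(2)) (simp add: dist_norm diff)
    qed
    then show "\<exists>N. openin T N \<and> x \<in> N \<and> N \<subseteq> {x. \<sigma> x \<in> W}"
      using openin_preimage_scaled_translate[OF V(1)] V(2) by (intro exI[of _ ?N]) auto
  qed
  then show "\<sigma> \<in> P" using r by (simp add: polar_def tdual_def linear_functional_iff continuous_map_def top)
qed

lemma polar_add: "\<sigma> \<in> P \<Longrightarrow> \<sigma> (x + y) = \<sigma> x + \<sigma> y"
  and polar_scale: "\<sigma> \<in> P \<Longrightarrow> \<sigma> (smul c x) = c * \<sigma> x"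
  by (simp_all add: mem_polar_iff)

lemma polar_diff: "\<sigma> \<in> P \<Longrightarrow> \<sigma> (x - y) = \<sigma> x - \<sigma> y"
  by (metis add_diff_cancel_right' diff_add_cancel polar_add)

lemma polar_zero: "\<sigma> \<in> P \<Longrightarrow> \<sigma> 0 = 0"
  using polar_diff[of \<sigma> 0 0] by simp

lemma polar_sum: "\<sigma> \<in> P \<Longrightarrow> \<sigma> (\<Sum>i<n. f i) = (\<Sum>i<n. \<sigma> (f i))" for n :: nat
  by (induction n) (simp_all add: polar_zero polar_add)

lemma zero_mem_polar: "(\<lambda>_. 0) \<in> P"
  by (simp add: mem_polar_iff)

lemma fconvex_polar: "fconvex P"
  unfolding fconvex_def
proof (intro ballI allI impI)
  fix f g and t :: real assume fg: "f \<in> P" "g \<in> P" "0 \<le> t \<and> t \<le> 1"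
  have "norm (of_real t * f x + of_real (1 - t) * g x) \<le> 1" if "x \<in> U" for x
  proof -
    have "norm (f x) \<le> 1" "norm (g x) \<le> 1" using fg that by (auto simp: mem_polar_iff)
    then have "t * norm (f x) + (1 - t) * norm (g x) \<le> 1"
      using convex_bound_le[of "norm (f x)" 1 "norm (g x)" t "1 - t"] fg by simp
    moreover have "norm (of_real t * f x + of_real (1 - t) * g x) \<le> t * norm (f x) + (1 - t) * norm (g x)"
      using fg by (intro order.trans[OF norm_triangle_ineq]) (simp add: norm_mult del: of_real_diff)
    ultimately show ?thesis by linarith
  qed
  then show "(\<lambda>x. of_real t * f x + of_real (1 - t) * g x) \<in> P"
    using fg by (simp add: mem_polar_iff algebra_simps del: of_real_diff)
qed

text \<open>A neighbourhood of zero absorbs every vector. The bound keeps the suprema in the weights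
  finite and provides the compact factors of the Banach--Alaoglu product.\<close>

lemma polar_pointwise_bounded: "\<exists>B. \<forall>\<sigma>\<in>P. norm (\<sigma> x) \<le> B"
proof -
  obtain V where V: "openin T V" "0 \<in> V" "V \<subseteq> U" by (rule zero_nhdE)
  obtain t :: real where "t > 0" "smul (of_real t) x \<in> V" using absorbing V by metis
  then have "norm (\<sigma> x) \<le> 1 / t" if "\<sigma> \<in> P" for \<sigma>
    by (intro norm_functional_le) (use that V in \<open>auto simp: mem_polar_iff\<close>)
  then show ?thesis by blast
qed

text \<open>Equicontinuity: closeness of \<open>A n\<close> to \<open>x\<close> is measured by a
  neighbourhood inside \<open>U\<close>, so one index serves all functionals of the polar.\<close>

lemma dense_approximation:
  assumes "e > 0"
  obtains n where "\<And>\<sigma>. \<sigma> \<in> P \<Longrightarrow> norm (\<sigma> (A n) - \<sigma> x) \<le> e"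
proof -
  obtain V where V: "openin T V" "0 \<in> V" "V \<subseteq> U" by (rule zero_nhdE)
  define N where "N = {y. smul (of_real (1/e)) (y - x) \<in> V}"
  have "openin T N" "x \<in> N" unfolding N_def using openin_preimage_scaled_translate[OF V(1)] V(2) by auto
  moreover have "x \<in> T closure_of (range A)" using dense by simp
  ultimately obtain y where "y \<in> range A" "y \<in> N" unfolding in_closure_of by blast
  then obtain n where n: "smul (of_real (1/e)) (A n - x) \<in> V" unfolding N_def by auto
  have "norm (\<sigma> (A n - x)) \<le> 1 / (1/e)" if "\<sigma> \<in> P" for \<sigma>
    by (rule norm_functional_le) (use that V n assms in \<open>auto simp: mem_polar_iff\<close>)
  then have "norm (\<sigma> (A n) - \<sigma> x) \<le> e" if "\<sigma> \<in> P" for \<sigma>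
    using that by (simp add: polar_diff)
  then show thesis by (rule that)
qed

section \<open>The series metric on the polar and its topology\<close>

definition weight :: "nat \<Rightarrow> real" where
  "weight n = 2 powr (- real n) / (1 + (SUP \<sigma>\<in>P. norm (\<sigma> (A n))))"

lemma polar_metric_eq: "pd \<sigma> \<tau> = (\<Sum>n. weight n * norm (\<sigma> (A n) - \<tau> (A n)))"
  by (simp add: polar_metric_def weight_def)

lemma norm_le_SUP:
  assumes "\<sigma> \<in> P"
  shows "norm (\<sigma> x) \<le> (SUP \<sigma>\<in>P. norm (\<sigma> x))" 
  using polar_pointwise_bounded[of x] assms by (auto intro!: cSUP_upper bdd_aboveI2)

lemma SUP_norm_nonneg: "0 \<le> (SUP \<sigma>\<in>P. norm (\<sigma> x))"
  using norm_le_SUP[OF zero_mem_polar, of x] by simp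

lemma weight_pos: "weight n > 0"
  using SUP_norm_nonneg[of "A n"] by (simp add: weight_def)

text \<open>The denominator \<open>1 + s\<close> of the weight cancels the a priori bound
  \<open>2 * (1 + s)\<close> for the difference. Indices start at 0, so these majorants sum to 4,
  the constant of \<open>bounded_pseudometric_polar\<close>.\<close>

lemma weight_norm_le:
  assumes "\<sigma> \<in> P" "\<tau> \<in> P"
  shows "weight n * norm (\<sigma> (A n) - \<tau> (A n)) \<le> 2 * (1/2) ^ n"
proof -
  define s where "s = (SUP \<sigma>\<in>P. norm (\<sigma> (A n)))"
  have s: "norm (\<upsilon> (A n)) \<le> s" if "\<upsilon> \<in> P" for \<upsilon> unfolding s_def by (rule norm_le_SUP[OF that])
  have "norm (\<sigma> (A n) - \<tau> (A n)) \<le> 2 * (1 + s)"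
    using order.trans[OF norm_triangle_ineq4 add_mono[OF s[OF assms(1)] s[OF assms(2)]]]
    by (simp add: distrib_left)
  then have "weight n * norm (\<sigma> (A n) - \<tau> (A n)) \<le> weight n * (2 * (1 + s))"
    using weight_pos by (simp add: less_imp_le)
  also have "\<dots> = 2 * 2 powr (- real n)"
    using SUP_norm_nonneg[of "A n"] by (simp add: weight_def add_nonneg_eq_0_iff field_simps flip: s_def)
  also have "\<dots> = 2 * (1/2) ^ n"
    by (simp add: powr_minus powr_realpow power_one_over inverse_eq_divide)
  finally show ?thesis .
qed

lemma summable_weight_norm:
  assumes "\<sigma> \<in> P" "\<tau> \<in> P"
  shows "summable (\<lambda>n. weight n * norm (\<sigma> (A n) - \<tau> (A n)))"
proof (rule summable_comparison_test')
  show "summable (\<lambda>n. 2 * (1/2::real) ^ n)" by (intro summable_mult summable_geometric) simp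
  show "norm (weight n * norm (\<sigma> (A n) - \<tau> (A n))) \<le> 2 * (1/2) ^ n" for n
    using weight_norm_le[OF assms] weight_pos[of n] by (simp add: abs_mult)
qed

lemma norm_coordinate_le_polar_metric:
  assumes "\<sigma> \<in> P" "\<tau> \<in> P"
  shows "weight n * norm (\<sigma> (A n) - \<tau> (A n)) \<le> pd \<sigma> \<tau>"
  unfolding polar_metric_eq
  using sum_le_suminf[OF summable_weight_norm[OF assms], of "{n}"] weight_pos by (simp add: less_imp_le)

text \<open>Replacing \<open>x\<close> by some \<open>A n\<close> costs \<open>e/2\<close> for each
  of the two functionals; that one coordinate is controlled by the series with
  \<open>K = 1 / weight n\<close>, whatever the functionals.\<close>

lemma norm_evaluation_le_polar_metric:
  assumes "e > 0"
  obtains K where "K \<ge> 0" "\<And>\<sigma> \<tau>. \<sigma> \<in> P \<Longrightarrow> \<tau> \<in> P \<Longrightarrow> norm (\<sigma> x - \<tau> x) \<le> e + K * pd \<sigma> \<tau>"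
proof -
  obtain n where n: "\<And>\<sigma>. \<sigma> \<in> P \<Longrightarrow> norm (\<sigma> (A n) - \<sigma> x) \<le> e/2"
    using dense_approximation[of "e/2" x] assms by auto
  have "norm (\<sigma> x - \<tau> x) \<le> e + (1 / weight n) * pd \<sigma> \<tau>" if "\<sigma> \<in> P" "\<tau> \<in> P" for \<sigma> \<tau>
  proof -
    have "\<sigma> x - \<tau> x = (\<sigma> (A n) - \<tau> (A n)) - (\<sigma> (A n) - \<sigma> x) + (\<tau> (A n) - \<tau> x)" by simp
    then have "norm (\<sigma> x - \<tau> x) \<le> norm (\<sigma> (A n) - \<tau> (A n)) + norm (\<sigma> (A n) - \<sigma> x) + norm (\<tau> (A n) - \<tau> x)"
      by (smt (verit) norm_triangle_ineq norm_triangle_ineq4)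
    moreover have "norm (\<sigma> (A n) - \<tau> (A n)) \<le> (1 / weight n) * pd \<sigma> \<tau>"
      using norm_coordinate_le_polar_metric[OF that, of n] weight_pos[of n] by (simp add: field_simps)
    ultimately show ?thesis using n[OF that(1)] n[OF that(2)] by linarith
  qed
  moreover have "1 / weight n \<ge> 0" using weight_pos[of n] by simp
  ultimately show thesis using that by blast
qed

lemma bounded_pseudometric_polar: "bounded_pseudometric P pd 4"
proof
  fix \<sigma> \<tau> \<upsilon> assume P: "\<sigma> \<in> P" "\<tau> \<in> P"
  show "0 \<le> pd \<sigma> \<tau>" unfolding polar_metric_eq
    using weight_pos by (intro suminf_nonneg summable_weight_norm P) (simp add: less_imp_le)
  show "pd \<sigma> \<tau> = pd \<tau> \<sigma>" by (simp add: polar_metric_eq norm_minus_commute)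
  have "pd \<sigma> \<tau> \<le> (\<Sum>n. 2 * (1/2) ^ n)" unfolding polar_metric_eq
    by (intro suminf_le weight_norm_le summable_weight_norm P summable_mult summable_geometric) simp
  also have "\<dots> = 4" by (simp add: suminf_mult summable_geometric suminf_geometric)
  finally show "pd \<sigma> \<tau> \<le> 4" .
  assume Q: "\<upsilon> \<in> P"
  have "pd \<sigma> \<upsilon> \<le> (\<Sum>n. weight n * norm (\<sigma> (A n) - \<tau> (A n)) + weight n * norm (\<tau> (A n) - \<upsilon> (A n)))"
    unfolding polar_metric_eq
  proof (intro suminf_le summable_add summable_weight_norm P Q)
    fix n
    have "weight n * norm (\<sigma> (A n) - \<upsilon> (A n)) \<le> weight n * (norm (\<sigma> (A n) - \<tau> (A n)) + norm (\<tau> (A n) - \<upsilon> (A n)))"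
      using weight_pos[of n] by (intro mult_left_mono norm_diff_triangle_le[OF order.refl order.refl]) simp
    then show "weight n * norm (\<sigma> (A n) - \<upsilon> (A n)) \<le> weight n * norm (\<sigma> (A n) - \<tau> (A n)) + weight n * norm (\<tau> (A n) - \<upsilon> (A n))"
      by (simp add: distrib_left)
  qed
  also have "\<dots> = pd \<sigma> \<tau> + pd \<tau> \<upsilon>" unfolding polar_metric_eq
    by (intro suminf_add[symmetric] summable_weight_norm P Q)
  finally show "pd \<sigma> \<upsilon> \<le> pd \<sigma> \<tau> + pd \<tau> \<upsilon>" .
qed (simp add: polar_metric_eq)

sublocale pdm: bounded_pseudometric P pd 4
  by (rule bounded_pseudometric_polar)

lemma polar_metric_eq_0D:
  assumes "\<sigma> \<in> P" "\<tau> \<in> P" "pd \<sigma> \<tau> = 0"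
  shows "\<sigma> = \<tau>"
proof
  fix x
  have "norm (\<sigma> x - \<tau> x) \<le> e" if "e > 0" for e
    using norm_evaluation_le_polar_metric[OF that, of x] assms by (metis add.right_neutral mult_zero_right)
  then have "norm (\<sigma> x - \<tau> x) \<le> 0" by (metis field_le_epsilon add_0)
  then show "\<sigma> x = \<tau> x" by simp
qed

sublocale pm: Metric_space P "restrict_dist P pd"
  using polar_metric_eq_0D by (intro pdm.Metric_space_restrict_dist) auto

text \<open>The metric is a sum of seminorms of the difference, hence jointly convex. This is what
  carries convexity over to Hausdorff limits.\<close>

lemma polar_metric_convex:
  assumes "\<sigma> \<in> P" "\<tau> \<in> P" "\<sigma>' \<in> P" "\<tau>' \<in> P" "0 \<le> t" "t \<le> 1"
  shows "pd (\<lambda>x. of_real t * \<sigma> x + of_real (1 - t) * \<sigma>' x) (\<lambda>x. of_real t * \<tau> x + of_real (1 - t) * \<tau>' x)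
    \<le> t * pd \<sigma> \<tau> + (1 - t) * pd \<sigma>' \<tau>'" (is "pd ?\<sigma> ?\<tau> \<le> _")
proof -
  have P: "?\<sigma> \<in> P" "?\<tau> \<in> P" using fconvex_polar assms unfolding fconvex_def by blast+
  have "pd ?\<sigma> ?\<tau> \<le> (\<Sum>n. t * (weight n * norm (\<sigma> (A n) - \<tau> (A n))) + (1 - t) * (weight n * norm (\<sigma>' (A n) - \<tau>' (A n))))"
    unfolding polar_metric_eq
  proof (intro suminf_le summable_weight_norm[OF P] summable_add summable_mult summable_weight_norm assms)
    fix n
    have "?\<sigma> (A n) - ?\<tau> (A n) = of_real t * (\<sigma> (A n) - \<tau> (A n)) + of_real (1 - t) * (\<sigma>' (A n) - \<tau>' (A n))"
      by (simp add: algebra_simps)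
    then have "norm (?\<sigma> (A n) - ?\<tau> (A n)) \<le> t * norm (\<sigma> (A n) - \<tau> (A n)) + (1 - t) * norm (\<sigma>' (A n) - \<tau>' (A n))"
      using norm_triangle_ineq[of "of_real t * (\<sigma> (A n) - \<tau> (A n))" "of_real (1 - t) * (\<sigma>' (A n) - \<tau>' (A n))"] assms
      by (simp add: norm_mult del: of_real_diff)
    then have "weight n * norm (?\<sigma> (A n) - ?\<tau> (A n)) \<le> weight n * (t * norm (\<sigma> (A n) - \<tau> (A n)) + (1 - t) * norm (\<sigma>' (A n) - \<tau>' (A n)))"
      using weight_pos[of n] by (intro mult_left_mono) auto
    then show "weight n * norm (?\<sigma> (A n) - ?\<tau> (A n)) \<le> t * (weight n * norm (\<sigma> (A n) - \<tau> (A n))) + (1 - t) * (weight n * norm (\<sigma>' (A n) - \<tau>' (A n)))"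
      by (simp add: algebra_simps)
  qed
  also have "\<dots> = (\<Sum>n. t * (weight n * norm (\<sigma> (A n) - \<tau> (A n)))) + (\<Sum>n. (1 - t) * (weight n * norm (\<sigma>' (A n) - \<tau>' (A n))))"
    by (intro suminf_add[symmetric] summable_mult summable_weight_norm assms)
  also have "\<dots> = t * pd \<sigma> \<tau> + (1 - t) * pd \<sigma>' \<tau>'"
    unfolding polar_metric_eq by (simp add: suminf_mult summable_weight_norm assms)
  finally show ?thesis .
qed

text \<open>After \<open>mem_polar_iff\<close> no continuity condition is left: each remaining one
  is closed and involves finitely many coordinates, so the polar is closed even among all
  functions.\<close>

lemma closed_polar: "closed P"
proof -
  have coord: "continuous_on UNIV (\<lambda>\<sigma>::'a \<Rightarrow> 'k. \<sigma> x)" for x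
    by (rule continuous_on_product_coordinates)
  have "P = {\<sigma>. (\<forall>x y. \<sigma> (x + y) = \<sigma> x + \<sigma> y) \<and> (\<forall>c x. \<sigma> (smul c x) = c * \<sigma> x) \<and> (\<forall>x. x \<in> U \<longrightarrow> norm (\<sigma> x) \<le> 1)}"
    by (simp add: set_eq_iff mem_polar_iff Ball_def)
  moreover have "closed \<dots>"
    by (intro closed_Collect_conj closed_Collect_all closed_Collect_imp closed_Collect_eq closed_Collect_le
        continuous_on_add continuous_on_mult continuous_on_norm coord continuous_on_const open_Collect_const)
  ultimately show ?thesis by simp
qed

text \<open>Banach--Alaoglu.\<close>
lemma compact_polar: "compact P"
proof -
  obtain B where B: "\<And>x \<sigma>. \<sigma> \<in> P \<Longrightarrow> norm (\<sigma> x) \<le> B x" using polar_pointwise_bounded by metis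
  have "compactin (product_topology (\<lambda>_. euclidean) UNIV) (PiE UNIV (\<lambda>x. cball (0::'k) (B x)))"
    by (simp add: compactin_PiE compact_cball_real_normed_field)
  then have "compact (PiE UNIV (\<lambda>x. cball (0::'k) (B x)))"
    by (simp add: euclidean_product_topology)
  moreover have "P \<subseteq> PiE UNIV (\<lambda>x. cball (0::'k) (B x))" using B by (auto simp: PiE_def)
  ultimately show ?thesis using closed_polar by (metis compact_Int_closed inf.absorb_iff2)
qed

lemma continuous_on_polar_metric:
  assumes "\<sigma> \<in> P"
  shows "continuous_on P (pd \<sigma>)"
  unfolding polar_metric_eq
proof (rule uniform_limit_theorem)
  show "uniform_limit P (\<lambda>n \<tau>. \<Sum>i<n. weight i * norm (\<sigma> (A i) - \<tau> (A i))) (\<lambda>\<tau>. \<Sum>i. weight i * norm (\<sigma> (A i) - \<tau> (A i))) sequentially"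
  proof (rule Weierstrass_m_test)
    show "summable (\<lambda>n. 2 * (1/2::real) ^ n)" by (intro summable_mult summable_geometric) simp
    show "norm (weight n * norm (\<sigma> (A n) - \<tau> (A n))) \<le> 2 * (1/2) ^ n" if "\<tau> \<in> P" for n \<tau>
      using weight_norm_le[OF assms that] weight_pos[of n] by (simp add: abs_mult)
  qed
  have coord: "continuous_on P (\<lambda>\<tau>. \<tau> x)" for x
    by (rule continuous_on_subset[OF continuous_on_product_coordinates]) simp
  show "\<forall>\<^sub>F n in sequentially. continuous_on P (\<lambda>\<tau>. \<Sum>i<n. weight i * norm (\<sigma> (A i) - \<tau> (A i)))"
    by (intro always_eventually allI continuous_on_sum continuous_on_mult continuous_on_norm
        continuous_on_diff continuous_on_const coord)
qed simp

lemma mtopology_polar: "pm.mtopology = top_of_set P"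
proof -
  have "continuous_map (top_of_set P) pm.mtopology id"
    unfolding pm.continuous_map_to_metric
  proof (intro ballI allI impI)
    fix \<sigma> e assume \<sigma>: "\<sigma> \<in> topspace (top_of_set P)" and e: "(e::real) > 0"
    then have "openin (top_of_set P) (P \<inter> pd \<sigma> -` {..<e})"
      using continuous_on_polar_metric[of \<sigma>] by (intro continuous_openin_preimage_gen) auto
    then show "\<exists>N. openin (top_of_set P) N \<and> \<sigma> \<in> N \<and> (\<forall>y\<in>N. id y \<in> pm.mball (id \<sigma>) e)"
      using \<sigma> e pdm.refl by (intro exI[of _ "P \<inter> pd \<sigma> -` {..<e}"]) (auto simp: restrict_dist_def)
  qed
  moreover have "compact_space (top_of_set P)" using compact_polar by (simp add: compact_space_subtopology)
  ultimately have "homeomorphic_map (top_of_set P) pm.mtopology id"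
    by (intro continuous_imp_homeomorphic_map pm.Hausdorff_space_mtopology) auto
  then show ?thesis by simp
qed

lemma compact_space_polar: "compact_space pm.mtopology"
  using compact_polar by (simp add: mtopology_polar compact_space_subtopology)

text \<open>The polar is closed, so for its subsets closedness relative to the dual and relative to
  the polar agree, and the latter is metric closedness.\<close>

lemma CU_eq: "CU smul T U = {F \<in> pm.closed_hyperspace. fconvex F}"
proof -
  have PT: "P \<subseteq> tdual smul T" by (auto simp: polar_def)
  have "closedin (weakstar smul T) F \<longleftrightarrow> closedin pm.mtopology F" if "F \<subseteq> P" for F
  proof -
    have w: "weakstar smul T = top_of_set (tdual smul T)"
      by (simp add: weakstar_def euclidean_product_topology)
    have "closedin (top_of_set P) F" if "closedin (top_of_set (tdual smul T)) F"
      using that \<open>F \<subseteq> P\<close> PT closedin_subset_trans by blast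
    moreover have "closedin (top_of_set (tdual smul T)) F" if "closedin (top_of_set P) F"
      using that closed_polar PT \<open>F \<subseteq> P\<close> by (metis closed_subset closedin_closed_trans subset_trans)
    ultimately show ?thesis unfolding w mtopology_polar by blast
  qed
  then show ?thesis
    unfolding CU_def pm.closed_hyperspace_def using closedin_subset[of pm.mtopology] by auto
qed

subsection \<open>The hyperspace of convex sets\<close>

lemma frakdH_eq: "frakdH smul T U A = hausdorff_dist pd"
  by (intro ext) (simp add: frakdH_def hausdorff_dist_def)

lemma dHA_eq: "dHA x = hausdorff_dist (\<lambda>\<sigma> \<tau>. norm (\<sigma> x - \<tau> x))"
  by (intro ext) (simp add: dHA_def hausdorff_dist_def)

lemma CU_D:
  assumes "F \<in> CU smul T U"
  shows "F \<noteq> {}" "F \<subseteq> P" "fconvex F" "F \<in> pm.closed_hyperspace" "compact F"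
proof -
  show F: "F \<in> pm.closed_hyperspace" "fconvex F" using assms by (auto simp: CU_eq)
  then show "F \<noteq> {}" "F \<subseteq> P" by (auto dest: pm.closed_hyperspaceD)
  have "closedin (top_of_set P) F" using F by (simp add: pm.closed_hyperspace_def mtopology_polar)
  then show "compact F" using compact_polar closedin_compact by blast
qed

lemma bounded_pseudometric_evaluation:
  "\<exists>C. bounded_pseudometric P (\<lambda>\<sigma> \<tau>. norm (\<sigma> x - \<tau> x)) C"
proof -
  obtain B where B: "\<And>\<sigma>. \<sigma> \<in> P \<Longrightarrow> norm (\<sigma> x) \<le> B" using polar_pointwise_bounded by metis
  have "bounded_pseudometric P (\<lambda>\<sigma> \<tau>. norm (\<sigma> x - \<tau> x)) (B + B)"
  proof
    show "norm (\<sigma> x - \<tau> x) \<le> B + B" if "\<sigma> \<in> P" "\<tau> \<in> P" for \<sigma> \<tau>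
      using that B by (intro order.trans[OF norm_triangle_ineq4] add_mono)
  qed (auto simp: norm_minus_commute intro: norm_diff_triangle_le)
  then show ?thesis by blast
qed

sublocale hm: Metric_space pm.closed_hyperspace pm.hyper_dist
proof -
  obtain C where "bounded_pseudometric P (restrict_dist P pd) C"
    using pm.compact_space_bounded_pseudometric[OF compact_space_polar] by blast
  then show "Metric_space pm.closed_hyperspace pm.hyper_dist"
    by (rule pm.Metric_space_closed_hyperspace)
qed

lemma hyper_dist_eq:
  assumes "F \<in> pm.closed_hyperspace" "G \<in> pm.closed_hyperspace"
  shows "pm.hyper_dist F G = hausdorff_dist pd F G"
  using assms pm.closed_hyperspaceD(2) by (simp add: restrict_dist_def[of pm.closed_hyperspace] hausdorff_dist_restrict_dist)

text \<open>Two points of \<open>F\<close> are moved into a nearby convex \<open>G\<close>, combined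
  there, and the combination is moved back. Joint convexity keeps the cost of the first move at
  \<open>e/2\<close>, and the return costs less than \<open>e/2\<close>.\<close>

lemma closedin_CU: "closedin hm.mtopology (CU smul T U)"
  unfolding hm.closedin_mtopology_iff_adherent
proof (intro conjI ballI impI)
  show "CU smul T U \<subseteq> pm.closed_hyperspace" by (auto simp: CU_eq)
  fix F assume F: "F \<in> pm.closed_hyperspace"
    and near: "\<forall>e>0. \<exists>G\<in>CU smul T U. pm.hyper_dist F G < e"
  note FD = pm.closed_hyperspaceD[OF F]
  have "fconvex F" unfolding fconvex_def
  proof (intro ballI allI impI)
    fix f g and t :: real assume fg: "f \<in> F" "g \<in> F" and t: "0 \<le> t \<and> t \<le> 1"
    let ?c = "\<lambda>f g x. of_real t * f x + of_real (1 - t) * g x"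
    have fgP: "f \<in> P" "g \<in> P" using fg FD(2) by auto
    then have hP: "?c f g \<in> P" using fconvex_polar t unfolding fconvex_def by blast
    have "\<exists>y\<in>F. restrict_dist P pd (?c f g) y < e" if "e > 0" for e
    proof -
      obtain G where G: "G \<in> CU smul T U" "pm.hyper_dist F G < e/2"
        using near half_gt_zero[OF \<open>e > 0\<close>] by blast
      note GD = CU_D[OF G(1)]
      have FG: "hausdorff_dist pd F G < e/2" using G F GD(4) by (simp add: hyper_dist_eq)
      then have GF: "hausdorff_dist pd G F < e/2" using pdm.hausdorff_dist_sym FD(2) GD(2) by simp
      obtain f' where f': "f' \<in> G" "pd f f' < e/2" by (rule pdm.hausdorff_dist_lessD[OF FD(2) GD(1,2) FG fg(1)])
      obtain g' where g': "g' \<in> G" "pd g g' < e/2" by (rule pdm.hausdorff_dist_lessD[OF FD(2) GD(1,2) FG fg(2)])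
      have c: "?c f' g' \<in> G" using GD(3) f' g' t unfolding fconvex_def by blast
      obtain y where y: "y \<in> F" "pd (?c f' g') y < e/2" by (rule pdm.hausdorff_dist_lessD[OF GD(2) FD(1,2) GF c])
      have "pd (?c f g) (?c f' g') \<le> t * pd f f' + (1 - t) * pd g g'"
        by (rule polar_metric_convex) (use fgP f' g' GD(2) t in auto)
      also have "\<dots> \<le> e/2"
        using convex_bound_le[of "pd f f'" "e/2" "pd g g'" t "1 - t"] f' g' t by simp
      finally have "pd (?c f g) (?c f' g') \<le> e/2" .
      moreover have "pd (?c f g) y \<le> pd (?c f g) (?c f' g') + pd (?c f' g') y"
        by (intro pdm.tri hP) (use c y GD(2) FD(2) in auto)
      ultimately have "pd (?c f g) y < e" using y by linarith
      then show ?thesis using y FD(2) hP by (auto simp: restrict_dist_def)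
    qed
    then show "?c f g \<in> F" using FD(3)[OF hP] by blast
  qed
  then show "F \<in> CU smul T U" using F by (simp add: CU_eq)
qed

sublocale cu: Submetric pm.closed_hyperspace pm.hyper_dist "CU smul T U"
  by unfold_locales (auto simp: CU_eq)

lemma compact_space_CU: "compact_space cu.sub.mtopology"
  unfolding cu.mtopology_submetric
  using closedin_compact_space[OF pm.compact_space_closed_hyperspace[OF compact_space_polar] closedin_CU]
  by (simp add: compact_space_subtopology)

lemma mball_CU:
  assumes "F \<in> CU smul T U"
  shows "cu.sub.mball F r = {G \<in> CU smul T U. frakdH smul T U A F G < r}"
  using assms CU_D(4) by (auto simp: cu.sub.mball_def frakdH_eq hyper_dist_eq)

text \<open>The functionals are evaluated at \<open>x = \<Sum> cj (\<tau>0 (A i) - \<sigma> (A i)) \<cdot> A i\<close>, where \<open>\<tau>0\<close> is a closest point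
  of \<open>G\<close> to \<open>\<sigma>\<close> for the Euclidean seminorm of finitely many coordinates; the lower bound is the
  variational inequality for \<open>\<tau>0\<close>.\<close>
lemma CU_separation:
  assumes \<sigma>: "\<sigma> \<in> P" and G: "G \<in> CU smul T U" and "\<sigma> \<notin> G"
  obtains x c where "c > 0" "\<And>\<tau>. \<tau> \<in> G \<Longrightarrow> c \<le> norm (\<sigma> x - \<tau> x)"
proof -
  note GD = CU_D[OF G]
  obtain re :: "'k \<Rightarrow> real" and cj :: "'k \<Rightarrow> 'k"
    where blr: "bounded_linear re" and blc: "bounded_linear cj"
      and comm: "\<And>x y. re (cj x * y) = re (cj y * x)" and posdef: "\<And>x. x \<noteq> 0 \<Longrightarrow> 0 < re (cj x * x)"
    using real_normed_field_conjugation by blast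
  interpret re: bounded_linear re by fact
  interpret cj: bounded_linear cj by fact
  define ip where "ip a b = re (cj a * b)" for a b
  have ip_add: "ip (a + b) c = ip a c + ip b c" "ip a (b + c) = ip a b + ip a c" for a b c
    by (simp_all add: ip_def cj.add re.add algebra_simps)
  have ip_scale: "ip (t *\<^sub>R a) b = t * ip a b" "ip a (t *\<^sub>R b) = t * ip a b" for t a b
    by (simp_all add: ip_def cj.scaleR re.scaleR)
  have ip_commute: "ip a b = ip b a" for a b using comm by (simp add: ip_def)
  have ip_nonneg: "0 \<le> ip a a" for a using posdef[of a] by (cases "a = 0") (auto simp: ip_def)
  define Q where "Q n \<tau> = (\<Sum>i<n. ip (\<tau> (A i) - \<sigma> (A i)) (\<tau> (A i) - \<sigma> (A i)))" for n :: nat and \<tau>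
  have Q_nonneg: "0 \<le> Q n \<tau>" for n \<tau> unfolding Q_def by (intro sum_nonneg ip_nonneg)
  \<comment> \<open>Finitely many coordinates tell \<open>\<sigma>\<close> from \<open>G\<close>.
    Otherwise, for each \<open>n\<close>, some point of \<open>G\<close> agrees with
    \<open>\<sigma>\<close> on the first \<open>n\<close> coordinates; only a tail of the series
    remains, and closedness puts \<open>\<sigma>\<close> in \<open>G\<close>.\<close>
  have "\<exists>n. \<forall>\<tau>\<in>G. Q n \<tau> \<noteq> 0"
  proof (rule ccontr)
    assume "\<not> ?thesis"
    then obtain \<tau> where \<tau>: "\<And>n. \<tau> n \<in> G" "\<And>n. Q n (\<tau> n) = 0" by metis
    have small: "pd \<sigma> (\<tau> n) \<le> 4 * (1/2) ^ n" for n
    proof -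
      have \<tau>P: "\<tau> n \<in> P" using \<tau>(1) GD(2) by blast
      have "ip (\<tau> n (A i) - \<sigma> (A i)) (\<tau> n (A i) - \<sigma> (A i)) = 0" if "i < n" for i
        using \<tau>(2)[of n] that unfolding Q_def by (simp add: sum_nonneg_eq_0_iff ip_nonneg)
      then have "\<tau> n (A i) = \<sigma> (A i)" if "i < n" for i
        using posdef[of "\<tau> n (A i) - \<sigma> (A i)"] that by (fastforce simp: ip_def)
      then have "pd \<sigma> (\<tau> n) = (\<Sum>i. weight (i + n) * norm (\<sigma> (A (i + n)) - \<tau> n (A (i + n))))"
        unfolding polar_metric_eq using suminf_split_initial_segment[OF summable_weight_norm[OF \<sigma> \<tau>P], of n] by simp
      also have "\<dots> \<le> (\<Sum>i. 2 * (1/2) ^ (i + n))"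
        by (intro suminf_le weight_norm_le \<sigma> \<tau>P summable_ignore_initial_segment summable_weight_norm
            summable_mult summable_geometric) simp
      also have "\<dots> = (\<Sum>i. (2 * (1/2) ^ n) * (1/2) ^ i)" by (simp add: power_add mult_ac)
      also have "\<dots> = 4 * (1/2) ^ n" by (simp add: suminf_mult summable_geometric suminf_geometric)
      finally show ?thesis .
    qed
    have "\<exists>y\<in>G. restrict_dist P pd \<sigma> y < e" if "e > 0" for e
    proof -
      obtain n where "(1/2::real) ^ n < e/4" using real_arch_pow_inv[of "e/4" "1/2"] \<open>e > 0\<close> by auto
      then have "pd \<sigma> (\<tau> n) < e" using small[of n] by linarith
      then show ?thesis using \<tau>(1)[of n] \<sigma> GD(2) by (auto simp: restrict_dist_def)
    qed
    then have "\<sigma> \<in> G" using pm.closed_hyperspaceD(3)[OF GD(4) \<sigma>] by blast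
    then show False using assms by blast
  qed
  then obtain n where n: "\<And>\<tau>. \<tau> \<in> G \<Longrightarrow> Q n \<tau> \<noteq> 0" by blast
  have coord: "continuous_on G (\<lambda>\<tau>. \<tau> y)" for y
    by (rule continuous_on_subset[OF continuous_on_product_coordinates]) simp
  have "continuous_on G (Q n)" unfolding Q_def ip_def
    by (intro continuous_on_sum bounded_linear.continuous_on[OF blr] continuous_on_mult
        bounded_linear.continuous_on[OF blc] continuous_on_diff coord continuous_on_const)
  then obtain \<tau>0 where \<tau>0: "\<tau>0 \<in> G" "\<And>\<tau>. \<tau> \<in> G \<Longrightarrow> Q n \<tau>0 \<le> Q n \<tau>"
    using continuous_attains_inf[OF GD(5,1)] by blast
  define m where "m = Q n \<tau>0"
  have m: "m > 0" using n[OF \<tau>0(1)] Q_nonneg[of n \<tau>0] by (simp add: m_def)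
  define \<delta> where "\<delta> i = \<tau>0 (A i) - \<sigma> (A i)" for i
  define x where "x = (\<Sum>i<n. smul (cj (\<delta> i)) (A i))"
  obtain K where K: "K > 0" "\<And>y. \<bar>re y\<bar> \<le> norm y * K" using re.pos_bounded by auto
  have "m / K \<le> norm (\<sigma> x - \<tau> x)" if \<tau>: "\<tau> \<in> G" for \<tau>
  proof -
    define \<eta> where "\<eta> i = \<tau> (A i) - \<tau>0 (A i)" for i
    define S where "S = (\<Sum>i<n. ip (\<delta> i) (\<eta> i))"
    define R where "R = (\<Sum>i<n. ip (\<eta> i) (\<eta> i))"
    have R: "R \<ge> 0" unfolding R_def by (intro sum_nonneg ip_nonneg)
    \<comment> \<open>Minimality of \<open>\<tau>0\<close> along the segment towards
      \<open>\<tau>\<close>, divided by \<open>t\<close>. The segment lies in \<open>G\<close> by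
      convexity.\<close>
    have var: "0 \<le> 2 * S + t * R" if t: "0 < t" "t \<le> 1" for t
    proof -
      let ?c = "\<lambda>x. of_real t * \<tau> x + of_real (1 - t) * \<tau>0 x"
      have "?c \<in> G" using GD(3) \<tau> \<tau>0(1) t unfolding fconvex_def by force
      then have "m \<le> Q n ?c" unfolding m_def by (rule \<tau>0(2))
      also have "Q n ?c = (\<Sum>i<n. ip (\<delta> i + t *\<^sub>R \<eta> i) (\<delta> i + t *\<^sub>R \<eta> i))"
        unfolding Q_def by (intro sum.cong refl arg_cong2[where f = ip])
          (simp_all add: \<delta>_def \<eta>_def scaleR_conv_of_real algebra_simps)
      also have "\<dots> = (\<Sum>i<n. ip (\<delta> i) (\<delta> i) + t * (2 * ip (\<delta> i) (\<eta> i) + t * ip (\<eta> i) (\<eta> i)))"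
        using ip_commute by (intro sum.cong refl) (simp add: ip_add ip_scale algebra_simps)
      also have "\<dots> = m + t * (2 * S + t * R)"
        by (simp add: m_def Q_def \<delta>_def S_def R_def sum.distrib flip: sum_distrib_left)
      finally show ?thesis using t by (simp add: zero_le_mult_iff)
    qed
    have "0 \<le> S"
    proof (rule ccontr)
      assume S: "\<not> 0 \<le> S"
      \<comment> \<open>This choice gives \<open>t * R \<le> - S\<close>, so \<open>var\<close>
        would force \<open>0 \<le> S\<close>; the \<open>+ 1\<close> guards against
        \<open>R = 0\<close>.\<close>
      define t where "t = min 1 (- S / (R + 1))"
      have "0 < t" "t \<le> 1" using S R by (auto simp: t_def divide_neg_pos)
      then have "0 \<le> 2 * S + t * R" by (rule var)
      moreover have "t * R \<le> (- S / (R + 1)) * R" using R by (intro mult_right_mono) (simp_all add: t_def)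
      moreover have "(- S / (R + 1)) * R \<le> - S" using S R by (simp add: field_simps)
      ultimately show False using S by linarith
    qed
    \<comment> \<open>The coordinates of \<open>\<tau> - \<sigma>\<close> are
      \<open>\<delta> i + \<eta> i\<close>; evaluation at \<open>x\<close> pairs them with
      \<open>\<delta>\<close>, so that \<open>re\<close> returns \<open>m + S\<close>.\<close>
    have "\<tau> x - \<sigma> x = (\<Sum>i<n. cj (\<delta> i) * (\<delta> i + \<eta> i))"
      using \<sigma> \<tau> GD(2) by (simp add: x_def polar_sum polar_scale subset_iff \<delta>_def \<eta>_def sum_subtractf algebra_simps)
    then have "re (\<tau> x - \<sigma> x) = (\<Sum>i<n. ip (\<delta> i) (\<delta> i + \<eta> i))"
      by (simp add: re.sum ip_def)
    also have "\<dots> = m + S" by (simp add: ip_add sum.distrib m_def Q_def S_def \<delta>_def)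
    finally have "m \<le> re (\<tau> x - \<sigma> x)" using \<open>0 \<le> S\<close> by simp
    also have "\<dots> \<le> norm (\<tau> x - \<sigma> x) * K" using K(2)[of "\<tau> x - \<sigma> x"] by linarith
    finally show ?thesis using K(1) by (simp add: field_simps norm_minus_commute)
  qed
  then show thesis using that[of "m / K" x] m K(1) by simp
qed

section \<open>The evaluation pseudometrics and the hypertopology\<close>

lemma dHA_refl:
  assumes "F \<in> CU smul T U"
  shows "dHA x F F = 0"
proof -
  obtain C where "bounded_pseudometric P (\<lambda>\<sigma> \<tau>. norm (\<sigma> x - \<tau> x)) C"
    using bounded_pseudometric_evaluation by blast
  then show ?thesis unfolding dHA_eq
    by (rule bounded_pseudometric.hausdorff_dist_refl) (use assms CU_D in blast)+
qed

lemma dHA_sym: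
  assumes "F \<in> CU smul T U" "G \<in> CU smul T U"
  shows "dHA x F G = dHA x G F"
proof -
  obtain C where "bounded_pseudometric P (\<lambda>\<sigma> \<tau>. norm (\<sigma> x - \<tau> x)) C"
    using bounded_pseudometric_evaluation by blast
  then show ?thesis unfolding dHA_eq
    by (rule bounded_pseudometric.hausdorff_dist_sym) (use assms CU_D in blast)+
qed

lemma dHA_triangle:
  assumes "F \<in> CU smul T U" "G \<in> CU smul T U" "H \<in> CU smul T U"
  shows "dHA x F H \<le> dHA x F G + dHA x G H"
proof -
  obtain C where "bounded_pseudometric P (\<lambda>\<sigma> \<tau>. norm (\<sigma> x - \<tau> x)) C"
    using bounded_pseudometric_evaluation by blast
  then show ?thesis unfolding dHA_eq
    by (rule bounded_pseudometric.hausdorff_dist_triangle) (use assms CU_D in blast)+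
qed

text \<open>A point of one set outside the other stays, under evaluation at a suitable vector, at a
  positive distance from the whole other set; this bounds one of the two suprema in
  \<open>dHA\<close> from below.\<close>

lemma dHA_positive:
  assumes F: "F \<in> CU smul T U" and G: "G \<in> CU smul T U" and "F \<noteq> G"
  obtains x where "0 < dHA x F G"
proof -
  have *: "\<exists>x. 0 < dHA x F G" if F: "F \<in> CU smul T U" and G: "G \<in> CU smul T U" and \<sigma>: "\<sigma> \<in> F" "\<sigma> \<notin> G" for F G \<sigma>
  proof -
    note FD = CU_D[OF F] and GD = CU_D[OF G]
    obtain c x where c: "c > 0" "\<And>\<tau>. \<tau> \<in> G \<Longrightarrow> c \<le> norm (\<sigma> x - \<tau> x)"
      by (rule CU_separation[OF subsetD[OF FD(2) \<sigma>(1)] G \<sigma>(2)], rule that)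
    obtain C where C: "bounded_pseudometric P (\<lambda>\<sigma> \<tau>. norm (\<sigma> x - \<tau> x)) C"
      using bounded_pseudometric_evaluation by blast
    have "c \<le> dHA x F G" unfolding dHA_eq
      by (rule bounded_pseudometric.hausdorff_dist_ge_dist_set[OF C FD(1,2) GD(1,2) \<sigma>(1)]) (rule c(2))
    then show ?thesis using c(1) by (intro exI[of _ x]) simp
  qed
  show thesis
  proof (cases "F \<subseteq> G")
    case True
    then obtain \<sigma> where "\<sigma> \<in> G" "\<sigma> \<notin> F" using \<open>F \<noteq> G\<close> by blast
    then show thesis using *[OF G F] dHA_sym[OF F G] that by metis
  next
    case False
    then obtain \<sigma> where "\<sigma> \<in> F" "\<sigma> \<notin> G" by blast
    then show thesis using *[OF F G] that by blast
  qed
qed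

lemma dHA_continuous:
  assumes "e > 0"
  obtains \<delta> where "\<delta> > 0" "\<And>F G. F \<in> CU smul T U \<Longrightarrow> G \<in> CU smul T U \<Longrightarrow> frakdH smul T U A F G < \<delta> \<Longrightarrow> dHA x F G < e"
proof -
  obtain C where C: "bounded_pseudometric P (\<lambda>\<sigma> \<tau>. norm (\<sigma> x - \<tau> x)) C"
    using bounded_pseudometric_evaluation by blast
  obtain K where K: "K \<ge> 0" "\<And>\<sigma> \<tau>. \<sigma> \<in> P \<Longrightarrow> \<tau> \<in> P \<Longrightarrow> norm (\<sigma> x - \<tau> x) \<le> e/3 + K * pd \<sigma> \<tau>"
    using norm_evaluation_le_polar_metric[of "e/3" x] assms by auto
  \<comment> \<open>\<open>K\<close> may be zero, hence \<open>K + 1\<close>. The total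
    \<open>e/3 + K * \<delta>\<close> is at most \<open>2 * e / 3\<close>, strictly below
    \<open>e\<close>.\<close>
  define \<delta> where "\<delta> = e / (3 * (K + 1))"
  have \<delta>: "\<delta> > 0" using assms K by (simp add: \<delta>_def)
  have "K * \<delta> \<le> e/3" using assms K by (simp add: \<delta>_def field_simps)
  have "dHA x F G < e"
    if "F \<in> CU smul T U" "G \<in> CU smul T U" "frakdH smul T U A F G < \<delta>" for F G
  proof -
    have "dHA x F G \<le> e/3 + K * \<delta>" unfolding dHA_eq
      by (rule pdm.hausdorff_dist_bounded_comparison[OF K(2,1) C])
        (use that CU_D in \<open>auto simp: frakdH_eq\<close>)
    then show ?thesis using \<open>K * \<delta> \<le> e/3\<close> assms by linarith
  qed
  then show thesis using that \<delta> by blast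
qed

lemma topspace_wsH: "topspace (wsH_topology smul T U) = CU smul T U"
proof -
  have "F \<in> \<Union>{{G \<in> CU smul T U. dHA x F G < r} | x F r. F \<in> CU smul T U \<and> r > 0}" if "F \<in> CU smul T U" for F
    by (rule UnionI[of "{G \<in> CU smul T U. dHA 0 F G < 1}"]) (use that dHA_refl in \<open>auto intro: zero_less_one\<close>)
  then show ?thesis unfolding wsH_topology_def topology_generated_by_topspace by blast
qed

lemma openin_wsH_ball:
  "F \<in> CU smul T U \<Longrightarrow> r > 0 \<Longrightarrow> openin (wsH_topology smul T U) {G \<in> CU smul T U. dHA x F G < r}"
  unfolding wsH_topology_def by (intro topology_generated_by_Basis) blast

lemma Hausdorff_space_wsH: "Hausdorff_space (wsH_topology smul T U)"
  unfolding Hausdorff_space_def topspace_wsH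
proof (intro allI impI)
  fix F G assume "F \<in> CU smul T U \<and> G \<in> CU smul T U \<and> F \<noteq> G"
  then have FG: "F \<in> CU smul T U" "G \<in> CU smul T U" "F \<noteq> G" by auto
  obtain x where x: "0 < dHA x F G" by (rule dHA_positive[OF FG])
  let ?r = "dHA x F G / 2"
  let ?B = "\<lambda>F. {H \<in> CU smul T U. dHA x F H < ?r}"
  have "disjnt (?B F) (?B G)"
  proof -
    have False if "H \<in> CU smul T U" "dHA x F H < ?r" "dHA x G H < ?r" for H
      using dHA_triangle[OF FG(1) that(1) FG(2), of x] dHA_sym[OF that(1) FG(2), of x] that by linarith
    then show ?thesis by (auto simp: disjnt_iff)
  qed
  moreover have "openin (wsH_topology smul T U) (?B F)" "openin (wsH_topology smul T U) (?B G)"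
    using FG x by (intro openin_wsH_ball; simp)+
  moreover have "F \<in> ?B F" "G \<in> ?B G" using FG x by (simp_all add: dHA_refl)
  ultimately show "\<exists>V W. openin (wsH_topology smul T U) V \<and> openin (wsH_topology smul T U) W \<and> F \<in> V \<and> G \<in> W \<and> disjnt V W"
    by blast
qed

lemma wsH_topology_eq: "wsH_topology smul T U = cu.sub.mtopology"
proof -
  have ball: "openin cu.sub.mtopology {G \<in> CU smul T U. dHA x F G < r}" if F: "F \<in> CU smul T U" for x F r
    unfolding cu.sub.openin_mtopology
  proof (intro conjI allI impI)
    fix G assume "G \<in> {G \<in> CU smul T U. dHA x F G < r}"
    then have G: "G \<in> CU smul T U" "dHA x F G < r" by auto
    \<comment> \<open>The generating set is centred at \<open>F\<close>; the radius left at
      \<open>G\<close> is \<open>r - dHA x F G\<close>.\<close>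
    then obtain \<delta> where \<delta>: "\<delta> > 0"
      "\<And>F' G'. F' \<in> CU smul T U \<Longrightarrow> G' \<in> CU smul T U \<Longrightarrow> frakdH smul T U A F' G' < \<delta> \<Longrightarrow> dHA x F' G' < r - dHA x F G"
      using dHA_continuous[of "r - dHA x F G" x] by auto
    have "dHA x F H < r" if "H \<in> CU smul T U" "frakdH smul T U A G H < \<delta>" for H
      using dHA_triangle[OF F G(1) that(1), of x] \<delta>(2)[OF G(1) that] by linarith
    then have "cu.sub.mball G \<delta> \<subseteq> {G \<in> CU smul T U. dHA x F G < r}"
      unfolding mball_CU[OF G(1)] by blast
    then show "\<exists>\<delta>>0. cu.sub.mball G \<delta> \<subseteq> {G \<in> CU smul T U. dHA x F G < r}" using \<delta>(1) by blast
  qed blast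
  have "continuous_map cu.sub.mtopology (wsH_topology smul T U) id"
    unfolding wsH_topology_def
  proof (rule continuous_on_generated_topo)
    fix B assume "B \<in> {{G \<in> CU smul T U. dHA x F G < r} | x F r. F \<in> CU smul T U \<and> r > 0}"
    then obtain x F r where B: "B = {G \<in> CU smul T U. dHA x F G < r}" and F: "F \<in> CU smul T U" by blast
    have "id -` B \<inter> topspace cu.sub.mtopology = B" unfolding B by auto
    then show "openin cu.sub.mtopology (id -` B \<inter> topspace cu.sub.mtopology)" using ball[OF F] B by simp
  qed (use topspace_wsH in \<open>simp add: wsH_topology_def\<close>)
  then have "homeomorphic_map cu.sub.mtopology (wsH_topology smul T U) id"
    by (intro continuous_imp_homeomorphic_map compact_space_CU Hausdorff_space_wsH) (auto simp: topspace_wsH)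
  then show ?thesis by simp
qed

end

theorem theorem3p17:
  fixes smul :: "'k::real_normed_field \<Rightarrow> 'a::ab_group_add \<Rightarrow> 'a"
    and T :: "'a topology" and U :: "'a set" and A :: "nat \<Rightarrow> 'a"
  assumes "tvs smul T"
    and "separable_space T"
    and "\<forall>x y. x \<noteq> y \<longrightarrow> (\<exists>\<sigma>\<in>tdual smul T. \<sigma> x \<noteq> \<sigma> y)"
    and "zero_nhd T U"
    and "T closure_of (range A) = UNIV"
  shows "(\<forall>B\<in>{{U2 \<in> CU smul T U. frakdH smul T U A U1 U2 < r} | U1 r. U1 \<in> CU smul T U \<and> r > 0}.
            openin (wsH_topology smul T U) B)
       \<and> (\<forall>W. openin (wsH_topology smul T U) W \<longrightarrow>
            (\<exists>\<B>. \<B> \<subseteq> {{U2 \<in> CU smul T U. frakdH smul T U A U1 U2 < r} | U1 r. U1 \<in> CU smul T U \<and> r > 0}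
                 \<and> \<Union>\<B> = W))
       \<and> compact_space (wsH_topology smul T U)
       \<and> completely_metrizable_space (wsH_topology smul T U)"
proof -
  interpret tvs_polar smul T U A by unfold_locales fact+
  let ?balls = "{{U2 \<in> CU smul T U. frakdH smul T U A U1 U2 < r} | U1 r. U1 \<in> CU smul T U \<and> r > 0}"
  \<comment> \<open>The sets of the statement are metric balls, so the basis claim reduces to the
    definition of a metric topology.\<close>
  have balls: "?balls = {cu.sub.mball F r | F r. F \<in> CU smul T U \<and> r > 0}"
    using mball_CU by (intro Collect_cong) (metis (no_types, lifting))
  have "\<exists>\<B>. \<B> \<subseteq> ?balls \<and> \<Union>\<B> = W" if W: "openin cu.sub.mtopology W" for W
  proof (intro exI conjI)
    let ?\<B> = "{B \<in> ?balls. B \<subseteq> W}"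
    show "?\<B> \<subseteq> ?balls" by blast
    show "\<Union>?\<B> = W"
    proof
      show "W \<subseteq> \<Union>?\<B>"
      proof
        fix F assume "F \<in> W"
        then obtain r where r: "r > 0" "cu.sub.mball F r \<subseteq> W" and F: "F \<in> CU smul T U"
          using W unfolding cu.sub.openin_mtopology by blast
        show "F \<in> \<Union>?\<B>"
        proof (rule UnionI)
          show "cu.sub.mball F r \<in> ?\<B>" unfolding balls using r F by blast
          show "F \<in> cu.sub.mball F r" using r F by simp
        qed
      qed
    qed blast
  qed
  moreover have "\<forall>B\<in>?balls. openin cu.sub.mtopology B"
    unfolding balls using cu.sub.openin_mball by blast
  moreover have "completely_metrizable_space cu.sub.mtopology"
    using compact_space_CU
    by (simp add: cu.sub.compact_space_eq_mcomplete_mtotally_bounded cu.sub.completely_metrizable_space_mtopology)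
  ultimately show ?thesis using compact_space_CU unfolding wsH_topology_eq by (intro conjI allI impI) simp_all
qed

end
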